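(* Let $(M,g)$, $M=\mathbb{R}\times S$, be an SOM-spacetime. Then $(M,g)$ is causally continuous if and only if it is future-distinguishing or past-distinguishing.
   Context: An SOM-spacetime is a product $M=\mathbb{R}\times S$ ($S$ a connected smooth manifold) with the Lorentzian metric $g=-\beta\,dt\otimes dt+dt\otimes\omega+\omega\otimes dt+g_0$, where $\beta:S\to(0,\infty)$ is a smooth function, $\omega$ a one-form on $S$, $g_0$ a symmetric $(0,2)$-tensor on $S$, and $g_0(v,v)+\frac1\beta\omega(v)^2>0$ for every nonzero $v\in TS$; it is time-oriented by the timelike Killing field $\partial_t$. $I^{\pm}(p)$ denote the chronological future/past of $p$. $(M,g)$ is past-distinguishing (respectively future-distinguishing) if $I^-(p)=I^-(q)$ (respectively $I^+(p)=I^+(q)$) implies $p=q$; distinguishing means both. Causally continuous means distinguishing and such that the set-valued maps $I^{\pm}$ are outer continuous, i.e. for every $p$ and every compact $K\subset M\setminus\overline{I^{\pm}(p)}$ there is a neighborhood $U$ of $p$ with $K\subset M\setminus\overline{I^{\pm}(q)}$ for all $q\in U$. *)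

theory Defs
  imports "HOL-Analysis.Analysis"
begin

text \<open>Only used on open sets, where the derivatives involved are unambiguous.\<close>

fun Ck_on :: "nat \<Rightarrow> 'a::real_normed_vector set \<Rightarrow> ('a \<Rightarrow> 'b::real_normed_vector) \<Rightarrow> bool" where
  "Ck_on 0 X f \<longleftrightarrow> continuous_on X f"
| "Ck_on (Suc k) X f \<longleftrightarrow>
     (\<forall>x\<in>X. f differentiable (at x)) \<and>
     (\<forall>v. Ck_on k X (\<lambda>x. frechet_derivative f (at x) v))"

definition smooth_on :: "'a::real_normed_vector set \<Rightarrow> ('a \<Rightarrow> 'b::real_normed_vector) \<Rightarrow> bool" where
  "smooth_on X f \<longleftrightarrow> (\<forall>k. Ck_on k X f)"

text \<open>The underlying set of a manifold is a whole type \<open>'s\<close>, whose class supplies the topology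
  (with the Hausdorff and second countability axioms); the model space is \<open>'e\<close>. A chart is a pair
  of its domain and the coordinate map, whose values outside the domain are irrelevant. Atlases are
  not required to be maximal, since every smooth atlas determines its smooth structure.\<close>

type_synonym ('s, 'e) chart = "'s set \<times> ('s \<Rightarrow> 'e)"

definition chart_inv :: "('s, 'e) chart \<Rightarrow> 'e \<Rightarrow> 's" where
  "chart_inv c = inv_into (fst c) (snd c)"

definition transition :: "('s, 'e) chart \<Rightarrow> ('s, 'e) chart \<Rightarrow> 'e \<Rightarrow> 'e" where
  "transition c d = snd d \<circ> chart_inv c"

definition smooth_atlas ::
  "('s::{t2_space, second_countable_topology}, 'e::euclidean_space) chart set \<Rightarrow> bool" where
  "smooth_atlas A \<longleftrightarrow>
     (\<Union>c\<in>A. fst c) = UNIV \<and>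
     (\<forall>c\<in>A. open (fst c) \<and> open (snd c ` fst c) \<and>
        homeomorphism (fst c) (snd c ` fst c) (snd c) (chart_inv c)) \<and>
     (\<forall>c\<in>A. \<forall>d\<in>A. smooth_on (snd c ` (fst c \<inter> fst d)) (transition c d))"

definition smooth_function ::
  "('s, 'e::euclidean_space) chart set \<Rightarrow> ('s \<Rightarrow> real) \<Rightarrow> bool" where
  "smooth_function A f \<longleftrightarrow> (\<forall>c\<in>A. smooth_on (snd c ` fst c) (f \<circ> chart_inv c))"

text \<open>A tangent vector at \<open>x\<close> is the family of its coordinate vectors in all charts around \<open>x\<close>,
  related by the derivatives of the transition maps. The value 0 at all other charts makes the
  family unique; the vector space operations are pointwise.\<close>

type_synonym ('s, 'e) tvec = "('s, 'e) chart \<Rightarrow> 'e"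

definition tangent_space ::
  "('s, 'e::euclidean_space) chart set \<Rightarrow> 's \<Rightarrow> ('s, 'e) tvec set" where
  "tangent_space A x =
     {v. (\<forall>c. \<not> (c \<in> A \<and> x \<in> fst c) \<longrightarrow> v c = 0) \<and>
         (\<forall>c\<in>A. \<forall>d\<in>A. x \<in> fst c \<inter> fst d \<longrightarrow>
            v d = frechet_derivative (transition c d) (at (snd c x)) (v c))}"

text \<open>The tangent vector at \<open>x\<close> whose coordinates in the chart \<open>c\<close> are \<open>e\<close>; for fixed \<open>e\<close> this
  is a constant-coefficient combination of the coordinate vector fields of \<open>c\<close>.\<close>

definition coord_vec ::
  "('s, 'e::euclidean_space) chart set \<Rightarrow> ('s, 'e) chart \<Rightarrow> 'e \<Rightarrow> 's \<Rightarrow> ('s, 'e) tvec" where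
  "coord_vec A c e x =
     (\<lambda>d. if d \<in> A \<and> x \<in> fst d
          then frechet_derivative (transition c d) (at (snd c x)) e else 0)"

definition linear_form_on ::
  "('s, 'e::euclidean_space) tvec set \<Rightarrow> (('s, 'e) tvec \<Rightarrow> real) \<Rightarrow> bool" where
  "linear_form_on V f \<longleftrightarrow>
     (\<forall>u\<in>V. \<forall>v\<in>V. f (\<lambda>c. u c + v c) = f u + f v) \<and>
     (\<forall>r. \<forall>v\<in>V. f (\<lambda>c. r *\<^sub>R v c) = r * f v)"

definition one_form ::
  "('s, 'e::euclidean_space) chart set \<Rightarrow> ('s \<Rightarrow> ('s, 'e) tvec \<Rightarrow> real) \<Rightarrow> bool" where
  "one_form A \<omega> \<longleftrightarrow>
     (\<forall>x. linear_form_on (tangent_space A x) (\<omega> x)) \<and>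
     (\<forall>c\<in>A. \<forall>e. smooth_on (snd c ` fst c)
        ((\<lambda>x. \<omega> x (coord_vec A c e x)) \<circ> chart_inv c))"

definition symmetric_2_tensor ::
  "('s, 'e::euclidean_space) chart set \<Rightarrow> ('s \<Rightarrow> ('s, 'e) tvec \<Rightarrow> ('s, 'e) tvec \<Rightarrow> real) \<Rightarrow> bool"
where
  "symmetric_2_tensor A h \<longleftrightarrow>
     (\<forall>x. \<forall>u\<in>tangent_space A x. \<forall>v\<in>tangent_space A x. h x u v = h x v u) \<and>
     (\<forall>x. \<forall>v\<in>tangent_space A x. linear_form_on (tangent_space A x) (\<lambda>u. h x u v)) \<and>
     (\<forall>c\<in>A. \<forall>e e'. smooth_on (snd c ` fst c)
        ((\<lambda>x. h x (coord_vec A c e x) (coord_vec A c e' x)) \<circ> chart_inv c))"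

text \<open>The locale predicate says that these data define an SOM-spacetime on \<open>\<real> \<times> S\<close>.\<close>

locale som_spacetime =
  fixes A :: "('s::{t2_space, second_countable_topology}, 'e::euclidean_space) chart set"
    and \<beta> :: "'s \<Rightarrow> real"
    and \<omega> :: "'s \<Rightarrow> ('s, 'e) tvec \<Rightarrow> real"
    and g0 :: "'s \<Rightarrow> ('s, 'e) tvec \<Rightarrow> ('s, 'e) tvec \<Rightarrow> real"
  assumes atlas: "smooth_atlas A"
    and connected_S: "connected (UNIV :: 's set)"
    and smooth_beta: "smooth_function A \<beta>"
    and beta_pos: "\<And>x. \<beta> x > 0"
    and one_form_omega: "one_form A \<omega>"
    and tensor_g0: "symmetric_2_tensor A g0"
    and positive: "\<And>x v. v \<in> tangent_space A x \<Longrightarrow> v \<noteq> (\<lambda>_. 0) \<Longrightarrow>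
      g0 x v v + (1 / \<beta> x) * (\<omega> x v)\<^sup>2 > 0"

text \<open>Under the identification \<open>T(\<real> \<times> S) = T\<real> \<times> TS\<close>, a tangent vector of \<open>\<real> \<times> S\<close> at \<open>(t, x)\<close> is
  a pair \<open>(a, u)\<close> with \<open>a = dt(a, u)\<close> and \<open>u\<close> in the tangent space of \<open>S\<close> at \<open>x\<close>.\<close>

definition som_metric ::
  "('s \<Rightarrow> real) \<Rightarrow> ('s \<Rightarrow> ('s, 'e) tvec \<Rightarrow> real) \<Rightarrow>
   ('s \<Rightarrow> ('s, 'e) tvec \<Rightarrow> ('s, 'e) tvec \<Rightarrow> real) \<Rightarrow>
   real \<times> 's \<Rightarrow> real \<times> ('s, 'e) tvec \<Rightarrow> real \<times> ('s, 'e) tvec \<Rightarrow> real" where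
  "som_metric \<beta> \<omega> g0 p V W =
     - \<beta> (snd p) * fst V * fst W + fst V * \<omega> (snd p) (snd W)
     + \<omega> (snd p) (snd V) * fst W + g0 (snd p) (snd V) (snd W)"

definition partial_t :: "real \<times> ('s, 'e::euclidean_space) tvec" where
  "partial_t = (1, \<lambda>_. 0)"

definition future_timelike ::
  "('s \<Rightarrow> real) \<Rightarrow> ('s \<Rightarrow> ('s, 'e::euclidean_space) tvec \<Rightarrow> real) \<Rightarrow>
   ('s \<Rightarrow> ('s, 'e) tvec \<Rightarrow> ('s, 'e) tvec \<Rightarrow> real) \<Rightarrow>
   real \<times> 's \<Rightarrow> real \<times> ('s, 'e) tvec \<Rightarrow> bool" where
  "future_timelike \<beta> \<omega> g0 p V \<longleftrightarrow>
     som_metric \<beta> \<omega> g0 p V V < 0 \<and> som_metric \<beta> \<omega> g0 p V partial_t < 0"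

text \<open>Continuity of the \<open>S\<close>-component makes the parameter sets in the last clause open.\<close>

definition smooth_curve_on ::
  "('s::topological_space, 'e::euclidean_space) chart set \<Rightarrow> real set \<Rightarrow> (real \<Rightarrow> real \<times> 's) \<Rightarrow> bool"
where
  "smooth_curve_on A J \<gamma> \<longleftrightarrow>
     smooth_on J (fst \<circ> \<gamma>) \<and> continuous_on J (snd \<circ> \<gamma>) \<and>
     (\<forall>c\<in>A. smooth_on {s\<in>J. snd (\<gamma> s) \<in> fst c} (snd c \<circ> snd \<circ> \<gamma>))"

definition velocity ::
  "('s, 'e::euclidean_space) chart set \<Rightarrow> (real \<Rightarrow> real \<times> 's) \<Rightarrow> real \<Rightarrow> real \<times> ('s, 'e) tvec" where
  "velocity A \<gamma> s =
     (vector_derivative (fst \<circ> \<gamma>) (at s),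
      \<lambda>c. if c \<in> A \<and> snd (\<gamma> s) \<in> fst c
          then vector_derivative (snd c \<circ> snd \<circ> \<gamma>) (at s) else 0)"

text \<open>Smoothness on a compact interval means having a smooth extension \<open>\<eta>\<close> to an open set
  containing it. At the breakpoints of a piecewise smooth curve both one-sided velocities have to
  be timelike and future-directed.\<close>

definition smooth_timelike_segment ::
  "('s::topological_space, 'e::euclidean_space) chart set \<Rightarrow> ('s \<Rightarrow> real) \<Rightarrow>
   ('s \<Rightarrow> ('s, 'e) tvec \<Rightarrow> real) \<Rightarrow> ('s \<Rightarrow> ('s, 'e) tvec \<Rightarrow> ('s, 'e) tvec \<Rightarrow> real) \<Rightarrow>
   real \<Rightarrow> real \<Rightarrow> (real \<Rightarrow> real \<times> 's) \<Rightarrow> bool" where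
  "smooth_timelike_segment A \<beta> \<omega> g0 a b \<gamma> \<longleftrightarrow>
     (\<exists>J \<eta>. open J \<and> {a..b} \<subseteq> J \<and> smooth_curve_on A J \<eta> \<and>
        (\<forall>s\<in>{a..b}. \<eta> s = \<gamma> s \<and> future_timelike \<beta> \<omega> g0 (\<eta> s) (velocity A \<eta> s)))"

definition future_timelike_curve ::
  "('s::topological_space, 'e::euclidean_space) chart set \<Rightarrow> ('s \<Rightarrow> real) \<Rightarrow>
   ('s \<Rightarrow> ('s, 'e) tvec \<Rightarrow> real) \<Rightarrow> ('s \<Rightarrow> ('s, 'e) tvec \<Rightarrow> ('s, 'e) tvec \<Rightarrow> real) \<Rightarrow>
   real \<Rightarrow> real \<Rightarrow> (real \<Rightarrow> real \<times> 's) \<Rightarrow> bool" where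
  "future_timelike_curve A \<beta> \<omega> g0 a b \<gamma> \<longleftrightarrow>
     a < b \<and>
     (\<exists>(n::nat) \<tau>. \<tau> 0 = a \<and> \<tau> n = b \<and>
        (\<forall>i<n. \<tau> i < \<tau> (Suc i) \<and>
           smooth_timelike_segment A \<beta> \<omega> g0 (\<tau> i) (\<tau> (Suc i)) \<gamma>))"

definition chron_future ::
  "('s::topological_space, 'e::euclidean_space) chart set \<Rightarrow> ('s \<Rightarrow> real) \<Rightarrow>
   ('s \<Rightarrow> ('s, 'e) tvec \<Rightarrow> real) \<Rightarrow> ('s \<Rightarrow> ('s, 'e) tvec \<Rightarrow> ('s, 'e) tvec \<Rightarrow> real) \<Rightarrow>
   real \<times> 's \<Rightarrow> (real \<times> 's) set" where
  "chron_future A \<beta> \<omega> g0 p =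
     {q. \<exists>a b \<gamma>. future_timelike_curve A \<beta> \<omega> g0 a b \<gamma> \<and> \<gamma> a = p \<and> \<gamma> b = q}"

definition chron_past ::
  "('s::topological_space, 'e::euclidean_space) chart set \<Rightarrow> ('s \<Rightarrow> real) \<Rightarrow>
   ('s \<Rightarrow> ('s, 'e) tvec \<Rightarrow> real) \<Rightarrow> ('s \<Rightarrow> ('s, 'e) tvec \<Rightarrow> ('s, 'e) tvec \<Rightarrow> real) \<Rightarrow>
   real \<times> 's \<Rightarrow> (real \<times> 's) set" where
  "chron_past A \<beta> \<omega> g0 p =
     {q. \<exists>a b \<gamma>. future_timelike_curve A \<beta> \<omega> g0 a b \<gamma> \<and> \<gamma> a = q \<and> \<gamma> b = p}"

definition future_distinguishing ::
  "('s::topological_space, 'e::euclidean_space) chart set \<Rightarrow> ('s \<Rightarrow> real) \<Rightarrow>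
   ('s \<Rightarrow> ('s, 'e) tvec \<Rightarrow> real) \<Rightarrow> ('s \<Rightarrow> ('s, 'e) tvec \<Rightarrow> ('s, 'e) tvec \<Rightarrow> real) \<Rightarrow> bool" where
  "future_distinguishing A \<beta> \<omega> g0 \<longleftrightarrow>
     (\<forall>p q. chron_future A \<beta> \<omega> g0 p = chron_future A \<beta> \<omega> g0 q \<longrightarrow> p = q)"

definition past_distinguishing ::
  "('s::topological_space, 'e::euclidean_space) chart set \<Rightarrow> ('s \<Rightarrow> real) \<Rightarrow>
   ('s \<Rightarrow> ('s, 'e) tvec \<Rightarrow> real) \<Rightarrow> ('s \<Rightarrow> ('s, 'e) tvec \<Rightarrow> ('s, 'e) tvec \<Rightarrow> real) \<Rightarrow> bool" where
  "past_distinguishing A \<beta> \<omega> g0 \<longleftrightarrow>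
     (\<forall>p q. chron_past A \<beta> \<omega> g0 p = chron_past A \<beta> \<omega> g0 q \<longrightarrow> p = q)"

definition outer_continuous :: "('m::topological_space \<Rightarrow> 'm set) \<Rightarrow> bool" where
  "outer_continuous I \<longleftrightarrow>
     (\<forall>p K. compact K \<and> K \<subseteq> UNIV - closure (I p) \<longrightarrow>
        (\<exists>U. open U \<and> p \<in> U \<and> (\<forall>q\<in>U. K \<subseteq> UNIV - closure (I q))))"

definition causally_continuous ::
  "('s::topological_space, 'e::euclidean_space) chart set \<Rightarrow> ('s \<Rightarrow> real) \<Rightarrow>
   ('s \<Rightarrow> ('s, 'e) tvec \<Rightarrow> real) \<Rightarrow> ('s \<Rightarrow> ('s, 'e) tvec \<Rightarrow> ('s, 'e) tvec \<Rightarrow> real) \<Rightarrow> bool" where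
  "causally_continuous A \<beta> \<omega> g0 \<longleftrightarrow>
     future_distinguishing A \<beta> \<omega> g0 \<and> past_distinguishing A \<beta> \<omega> g0 \<and>
     outer_continuous (chron_future A \<beta> \<omega> g0) \<and> outer_continuous (chron_past A \<beta> \<omega> g0)"

end

theory Submission imports Defs begin

text \<open>Write \<open>p \<lless> q\<close> if \<open>q\<close> lies in the chronological future of \<open>p\<close>. Time translations are
  isometries, so \<open>\<lless>\<close> is described by the sets of delays \<open>t\<close> with \<open>(0, x) \<lless> (t, y)\<close>, and hence
  by their infima \<open>d x y\<close>. Such a set is nonempty because \<open>S\<close> is connected, and it is an open
  half line or the whole line. Concatenation of curves makes \<open>d\<close> satisfy the triangle inequality.

  If some point can reach its own past along its \<open>t\<close>-line, going round repeatedly shows that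
  \<open>\<lless>\<close> relates all pairs of points. All chronological futures and pasts then equal the whole
  space: they vary outer continuously, and neither of the two distinguishing conditions holds.

  Otherwise \<open>d\<close> is finite, vanishes on the diagonal, and is continuous because nearby points
  reach each other with an arbitrarily small delay. The future of \<open>p\<close> is the set where the
  continuous function \<open>q \<mapsto> fst q - fst p - d (snd p) (snd q)\<close> is positive, and its closure the set
  where it is nonnegative; joint continuity in \<open>p\<close> and \<open>q\<close> gives outer continuity, and pasts are
  treated in the same way (\<open>outer_continuous_prec\<close>). Moreover \<open>p\<close> and \<open>q\<close> have the same future
  iff \<open>d (snd p) (snd q) = fst q - fst p = - d (snd q) (snd p)\<close>, and this is also the condition for
  having the same past (\<open>future_eq_iff_past_eq\<close>). Hence outer continuity always holds, and
  distinguishing the future is equivalent to distinguishing the past.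

  Four facts about \<open>\<lless>\<close> enter the argument: it is transitive and invariant under time
  translations, nearby points of \<open>S\<close> are related with small delay, and the infimum of a set of
  delays is not attained. The last two are local. In a chart the future timelike vectors form an
  open set (\<open>open_chart_cone\<close>), so segments that are straight in the chart are timelike as soon
  as their constant velocity is close to a future timelike vector. This yields short timelike
  segments between neighbouring points, and it allows the last piece of a timelike curve to be
  replaced by a chord that arrives slightly earlier.\<close>

section \<open>Smooth maps and affine substitutions\<close>

lemma Ck_on_cong:
  assumes "open X" "\<And>x. x \<in> X \<Longrightarrow> f x = g x"
  shows "Ck_on k X f \<longleftrightarrow> Ck_on k X g"
  using assms(2)
proof (induction k arbitrary: f g)
  case 0
  then show ?case by (auto cong: continuous_on_cong)
next
  case (Suc k)
  have D: "(f has_derivative f') (at x) \<longleftrightarrow> (g has_derivative f') (at x)" if "x \<in> X" for f' x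
    using that Suc.prems assms(1)
      has_derivative_transform_within_open[of f f' x UNIV X g]
      has_derivative_transform_within_open[of g f' x UNIV X f] by auto
  then have "f differentiable (at x) \<longleftrightarrow> g differentiable (at x)" if "x \<in> X" for x
    using that by (simp add: differentiable_def)
  moreover have "frechet_derivative f (at x) = frechet_derivative g (at x)" if "x \<in> X" for x
    using D that by (simp add: frechet_derivative_def)
  ultimately show ?case
    using Suc.IH[of "\<lambda>x. frechet_derivative f (at x) v" "\<lambda>x. frechet_derivative g (at x) v" for v]
    by simp
qed

lemma Ck_on_subset:
  assumes "Ck_on k X f" "Y \<subseteq> X"
  shows "Ck_on k Y f"
  using assms by (induction k arbitrary: f) (auto intro: continuous_on_subset)

lemma Ck_on_const: "Ck_on k X (\<lambda>x. c)"
proof (induction k arbitrary: c)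
  case (Suc k)
  then show ?case by (simp add: frechet_derivative_const)
qed simp

text \<open>The derivative of \<open>s \<mapsto> f (a + s w)\<close> in direction \<open>r\<close> is a directional derivative of \<open>f\<close> in
  the fixed direction \<open>r w\<close> along the same line, so the statement reproduces itself under
  differentiation.\<close>

lemma Ck_on_comp_affine:
  fixes f :: "'a::real_normed_vector \<Rightarrow> 'b::real_normed_vector" and a w :: 'a
  assumes "Ck_on k X f" "open X"
  shows "Ck_on k {s::real. a + s *\<^sub>R w \<in> X} (\<lambda>s. f (a + s *\<^sub>R w))"
  using assms(1)
proof (induction k arbitrary: f)
  case 0
  then show ?case
    by (auto intro!: continuous_on_compose2[of X f] continuous_intros)
next
  case (Suc k)
  let ?J = "{s::real. a + s *\<^sub>R w \<in> X}"
  have "?J = (\<lambda>s. a + s *\<^sub>R w) -` X" by auto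
  then have J: "open ?J"
    using assms(2) by (auto intro!: open_vimage continuous_intros)
  have D: "((\<lambda>s. f (a + s *\<^sub>R w)) has_derivative
      (\<lambda>r. frechet_derivative f (at (a + s *\<^sub>R w)) (r *\<^sub>R w))) (at s)" if "s \<in> ?J" for s
  proof -
    have "f differentiable (at (a + s *\<^sub>R w))" using Suc.prems that by simp
    then have f: "(f has_derivative frechet_derivative f (at (a + s *\<^sub>R w))) (at (a + s *\<^sub>R w))"
      by (simp add: frechet_derivative_works)
    have "((\<lambda>s. a + s *\<^sub>R w) has_derivative (\<lambda>r. r *\<^sub>R w)) (at s)"
      by (auto intro!: derivative_eq_intros)
    from has_derivative_compose[OF this f] show ?thesis .
  qed
  have "(\<lambda>s. f (a + s *\<^sub>R w)) differentiable (at s)" if "s \<in> ?J" for s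
    using D[OF that] by (auto simp: differentiable_def)
  moreover have "Ck_on k ?J (\<lambda>s. frechet_derivative (\<lambda>s. f (a + s *\<^sub>R w)) (at s) r)" for r
  proof -
    have "Ck_on k X (\<lambda>x. frechet_derivative f (at x) (r *\<^sub>R w))" using Suc.prems by simp
    from Suc.IH[OF this]
    have "Ck_on k ?J (\<lambda>s. frechet_derivative f (at (a + s *\<^sub>R w)) (r *\<^sub>R w))" .
    moreover have "frechet_derivative (\<lambda>s. f (a + s *\<^sub>R w)) (at s) r =
        frechet_derivative f (at (a + s *\<^sub>R w)) (r *\<^sub>R w)" if "s \<in> ?J" for s
      using fun_cong[OF frechet_derivative_at[OF D[OF that]], of r] by simp
    ultimately show ?thesis using Ck_on_cong[OF J] by (metis (no_types, lifting))
  qed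
  ultimately show ?case by simp
qed

lemma smooth_on_comp_affine:
  assumes "smooth_on X f" "open X"
  shows "smooth_on {s::real. a + s *\<^sub>R w \<in> X} (\<lambda>s. f (a + s *\<^sub>R w))"
  using assms by (simp add: smooth_on_def Ck_on_comp_affine)

lemma Ck_on_add_const:
  assumes "Ck_on k X f" "open X"
  shows "Ck_on k X (\<lambda>x. c + f x)"
proof (cases k)
  case 0
  then show ?thesis using assms by (auto intro: continuous_intros)
next
  case (Suc j)
  have D: "((\<lambda>x. c + f x) has_derivative frechet_derivative f (at x)) (at x)" if "x \<in> X" for x
  proof -
    have "(f has_derivative frechet_derivative f (at x)) (at x)"
      using assms that Suc by (simp add: frechet_derivative_works)
    then show ?thesis by (auto intro!: derivative_eq_intros)
  qed
  have E: "frechet_derivative (\<lambda>x. c + f x) (at x) = frechet_derivative f (at x)" if "x \<in> X" for x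
    using frechet_derivative_at[OF D[OF that]] by simp
  have "Ck_on j X (\<lambda>x. frechet_derivative (\<lambda>x. c + f x) (at x) v)" for v
    using Ck_on_cong[OF assms(2), of "\<lambda>x. frechet_derivative (\<lambda>x. c + f x) (at x) v"
        "\<lambda>x. frechet_derivative f (at x) v"] E assms(1) Suc by simp
  then show ?thesis using D Suc by (auto simp: differentiable_def)
qed

lemma smooth_on_id: "smooth_on X (\<lambda>x. x)"
  unfolding smooth_on_def
proof
  fix k show "Ck_on k X (\<lambda>x. x)"
    by (cases k) (auto simp: Ck_on_const)
qed


lemma smooth_on_subset: "smooth_on X f \<Longrightarrow> Y \<subseteq> X \<Longrightarrow> smooth_on Y f"
  by (auto simp: smooth_on_def intro: Ck_on_subset)

lemma smooth_on_imp_continuous_on: "smooth_on X f \<Longrightarrow> continuous_on X f"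
  unfolding smooth_on_def by (metis Ck_on.simps(1))

lemma smooth_on_imp_differentiable: "smooth_on X f \<Longrightarrow> x \<in> X \<Longrightarrow> f differentiable (at x)"
  unfolding smooth_on_def by (metis Ck_on.simps(2))

text \<open>The equivalence identifies the \<^const>\<open>vector_derivative\<close> of both functions everywhere, also at
  parameters where neither is differentiable and the value is unspecified.\<close>

lemma has_vector_derivative_shift:
  "((\<lambda>s::real. r + f (s - k)) has_vector_derivative D) (at s) \<longleftrightarrow>
   (f has_vector_derivative D) (at (s - k))"
proof -
  have *: "((\<lambda>s::real. r + f (s - k)) has_vector_derivative D) (at s)"
    if "(f has_vector_derivative D) (at (s - k))" for r f k s
  proof -
    have "((\<lambda>s::real. s - k) has_vector_derivative 1) (at s)"
      by (auto intro!: derivative_eq_intros)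
    from vector_diff_chain_at[OF this, of f D] that
    have "((\<lambda>s. f (s - k)) has_vector_derivative D) (at s)" by (simp add: o_def)
    then show ?thesis by (auto intro!: derivative_eq_intros)
  qed
  show ?thesis
    using *[of f s k r] *[of "\<lambda>s. r + f (s - k)" "s - k" "-k" "-r"] by auto
qed

text \<open>Coefficients of forms are only given to be continuous for fixed coordinate vectors. Expansion
  in a finite basis turns this into joint continuity in the point and the vector.\<close>

lemma continuous_on_linear_family:
  fixes f :: "'a::topological_space \<Rightarrow> 'e::euclidean_space \<Rightarrow> real"
  assumes "\<And>t. t \<in> T \<Longrightarrow> linear (f t)"
    and "\<And>i. i \<in> Basis \<Longrightarrow> continuous_on T (\<lambda>t. f t i)"
    and "continuous_on T e"
  shows "continuous_on T (\<lambda>t. f t (e t))"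
proof -
  have "f t (e t) = (\<Sum>i\<in>Basis. (e t \<bullet> i) * f t i)" if "t \<in> T" for t
  proof -
    have "f t (\<Sum>i\<in>Basis. (e t \<bullet> i) *\<^sub>R i) = (\<Sum>i\<in>Basis. (e t \<bullet> i) * f t i)"
      using assms(1)[OF that] by (simp add: linear_sum linear_scale)
    then show ?thesis by (simp add: euclidean_representation)
  qed
  moreover have "continuous_on T (\<lambda>t. \<Sum>i\<in>Basis. (e t \<bullet> i) * f t i)"
    using assms(2,3) by (intro continuous_intros)
  ultimately show ?thesis by (simp cong: continuous_on_cong)
qed

section \<open>Tangent vectors in coordinates\<close>

context som_spacetime
begin

lemma chart:
  assumes "c \<in> A"
  shows open_chart_domain: "open (fst c)"
    and open_chart_image: "open (snd c ` fst c)"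
    and chart_homeomorphism: "homeomorphism (fst c) (snd c ` fst c) (snd c) (chart_inv c)"
  using atlas assms by (auto simp: smooth_atlas_def)

lemma chart_inverse:
  assumes "c \<in> A"
  shows chart_inv_chart: "x \<in> fst c \<Longrightarrow> chart_inv c (snd c x) = x"
    and chart_chart_inv: "\<xi> \<in> snd c ` fst c \<Longrightarrow> snd c (chart_inv c \<xi>) = \<xi>"
    and chart_inv_in: "\<xi> \<in> snd c ` fst c \<Longrightarrow> chart_inv c \<xi> \<in> fst c"
  using chart_homeomorphism[OF assms] by (auto simp: homeomorphism_def)

lemma continuous_on_chart_inv: "c \<in> A \<Longrightarrow> continuous_on (snd c ` fst c) (chart_inv c)"
  and continuous_on_chart: "c \<in> A \<Longrightarrow> continuous_on (fst c) (snd c)"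
  using chart_homeomorphism by (auto simp: homeomorphism_def)

lemma chart_at: obtains c where "c \<in> A" "x \<in> fst c"
proof -
  have "x \<in> (\<Union>c\<in>A. fst c)" using atlas by (simp add: smooth_atlas_def)
  then show thesis using that by blast
qed

lemma overlap_image:
  assumes "c \<in> A"
  shows "snd c ` (fst c \<inter> fst d) = {\<xi> \<in> snd c ` fst c. chart_inv c \<xi> \<in> fst d}"
  using chart_inverse[OF assms] by auto

lemma open_overlap_image:
  assumes "c \<in> A" "d \<in> A"
  shows "open (snd c ` (fst c \<inter> fst d))"
proof -
  have "snd c ` (fst c \<inter> fst d) = snd c ` fst c \<inter> chart_inv c -` fst d"
    unfolding overlap_image[OF assms(1)] by blast
  then show ?thesis
    using continuous_open_preimage[OF continuous_on_chart_inv] assms chart by metis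
qed

lemma has_derivative_transition:
  assumes "c \<in> A" "d \<in> A" "x \<in> fst c" "x \<in> fst d"
  shows "(transition c d has_derivative frechet_derivative (transition c d) (at (snd c x)))
    (at (snd c x))"
proof -
  have "smooth_on (snd c ` (fst c \<inter> fst d)) (transition c d)"
    using atlas assms by (auto simp: smooth_atlas_def)
  then have "transition c d differentiable (at (snd c x))"
    using assms by (auto intro: smooth_on_imp_differentiable)
  then show ?thesis by (simp add: frechet_derivative_works)
qed

text \<open>The compatibility of the coordinates in two charts \<open>d\<close> and \<open>d'\<close> is the chain rule for
  \<open>transition c d' = transition d d' \<circ> transition c d\<close>.\<close>

lemma coord_vec_in_tangent_space:
  assumes "c \<in> A" "x \<in> fst c"
  shows "coord_vec A c e x \<in> tangent_space A x"
proof -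
  have chain: "frechet_derivative (transition c d') (at (snd c x)) e =
      frechet_derivative (transition d d') (at (snd d x))
        (frechet_derivative (transition c d) (at (snd c x)) e)"
    if "d \<in> A" "d' \<in> A" "x \<in> fst d" "x \<in> fst d'" for d d'
  proof -
    let ?W = "snd c ` (fst c \<inter> fst d)"
    have x: "transition c d (snd c x) = snd d x"
      using chart_inv_chart assms by (simp add: transition_def)
    have "(transition d d' has_derivative frechet_derivative (transition d d') (at (snd d x)))
        (at (transition c d (snd c x)))"
      using has_derivative_transition that x by simp
    from has_derivative_compose[OF has_derivative_transition[OF assms(1) that(1) assms(2) that(3)] this]
    have "((\<lambda>\<xi>. transition d d' (transition c d \<xi>)) has_derivative
        (\<lambda>e. frechet_derivative (transition d d') (at (snd d x))
          (frechet_derivative (transition c d) (at (snd c x)) e))) (at (snd c x))" .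
    then have "(transition c d' has_derivative
        (\<lambda>e. frechet_derivative (transition d d') (at (snd d x))
          (frechet_derivative (transition c d) (at (snd c x)) e))) (at (snd c x))"
      by (rule has_derivative_transform_within_open[OF _ open_overlap_image[OF assms(1) that(1)]])
        (use assms that in \<open>auto simp: transition_def chart_inv_chart\<close>)
    from fun_cong[OF frechet_derivative_at[OF this], of e] show ?thesis by (rule sym)
  qed
  show ?thesis
    unfolding tangent_space_def mem_Collect_eq
  proof (intro conjI allI ballI impI)
    show "coord_vec A c e x d = 0" if "\<not> (d \<in> A \<and> x \<in> fst d)" for d
      using that by (auto simp: coord_vec_def)
    fix d d' assume "d \<in> A" "d' \<in> A" "x \<in> fst d \<inter> fst d'"
    then show "coord_vec A c e x d' =
        frechet_derivative (transition d d') (at (snd d x)) (coord_vec A c e x d)"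
      using chain[of d d'] by (simp add: coord_vec_def)
  qed
qed

lemma linear_comp_coord_vec:
  assumes "c \<in> A" "x \<in> fst c" "linear_form_on (tangent_space A x) f"
  shows "linear (\<lambda>e. f (coord_vec A c e x))"
proof -
  have L: "linear (frechet_derivative (transition c d) (at (snd c x)))" if "d \<in> A" "x \<in> fst d" for d
    using has_derivative_transition[OF assms(1) that(1) assms(2) that(2)] has_derivative_linear by blast
  have "coord_vec A c (u + v) x = (\<lambda>d. coord_vec A c u x d + coord_vec A c v x d)" for u v
    using L by (auto simp: coord_vec_def linear_add)
  moreover have "coord_vec A c (r *\<^sub>R v) x = (\<lambda>d. r *\<^sub>R coord_vec A c v x d)" for r v
    using L by (auto simp: coord_vec_def linear_scale)
  ultimately show ?thesis
    using assms(3) coord_vec_in_tangent_space[OF assms(1,2)]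
    by (auto intro!: linearI simp: linear_form_on_def)
qed

lemma linear_omega_coord:
  assumes "c \<in> A" "x \<in> fst c"
  shows "linear (\<lambda>e. \<omega> x (coord_vec A c e x))"
  using linear_comp_coord_vec assms one_form_omega by (simp add: one_form_def)

lemma linear_g0_coord:
  assumes "c \<in> A" "x \<in> fst c"
  shows linear_g0_coord_left: "linear (\<lambda>e. g0 x (coord_vec A c e x) (coord_vec A c e' x))"
    and linear_g0_coord_right: "linear (\<lambda>e. g0 x (coord_vec A c e' x) (coord_vec A c e x))"
proof -
  show L: "linear (\<lambda>e. g0 x (coord_vec A c e x) (coord_vec A c e' x))"
    using linear_comp_coord_vec[OF assms, of "\<lambda>u. g0 x u (coord_vec A c e' x)"]
      tensor_g0 coord_vec_in_tangent_space[OF assms] by (simp add: symmetric_2_tensor_def)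
  have "g0 x (coord_vec A c e' x) (coord_vec A c e x) =
      g0 x (coord_vec A c e x) (coord_vec A c e' x)" for e
    using tensor_g0 coord_vec_in_tangent_space[OF assms] by (simp add: symmetric_2_tensor_def)
  then show "linear (\<lambda>e. g0 x (coord_vec A c e' x) (coord_vec A c e x))"
    using L by simp
qed

section \<open>Future timelike vectors in a chart\<close>

text \<open>Elements are triples of a time component, the coordinates of a base point, and a coordinate
  vector. Since the metric is invariant under time translations, base points at time 0 suffice.\<close>

definition chart_cone :: "('s, 'e) chart \<Rightarrow> (real \<times> 'e \<times> 'e) set" where
  "chart_cone c = {(\<tau>, \<xi>, v). \<xi> \<in> snd c ` fst c \<and>
     future_timelike \<beta> \<omega> g0 (0, chart_inv c \<xi>) (\<tau>, coord_vec A c v (chart_inv c \<xi>))}"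

lemma future_timelike_time_invariant:
  "future_timelike \<beta> \<omega> g0 (t, x) V \<longleftrightarrow> future_timelike \<beta> \<omega> g0 (s, x) V"
  by (simp add: future_timelike_def som_metric_def)

lemma future_timelike_coord:
  assumes "c \<in> A" "x \<in> fst c"
  shows "future_timelike \<beta> \<omega> g0 (t, x) (\<tau>, coord_vec A c v x) \<longleftrightarrow>
    - \<beta> x * \<tau> * \<tau> + 2 * \<tau> * \<omega> x (coord_vec A c v x)
      + g0 x (coord_vec A c v x) (coord_vec A c v x) < 0 \<and>
    - \<beta> x * \<tau> + \<omega> x (coord_vec A c v x) < 0"
proof -
  have Z: "coord_vec A c 0 x = (\<lambda>_. 0)"
    using linear_0[OF has_derivative_linear[OF has_derivative_transition[OF assms(1) _ assms(2)]]]
    by (simp add: coord_vec_def fun_eq_iff)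
  have "\<omega> x (\<lambda>_. 0) = 0"
    using linear_0[OF linear_omega_coord[OF assms]] Z by simp
  moreover have "g0 x (coord_vec A c v x) (\<lambda>_. 0) = 0"
    using linear_0[OF linear_g0_coord_right[OF assms, of v]] Z by simp
  ultimately show ?thesis
    by (simp add: future_timelike_def som_metric_def partial_t_def algebra_simps)
qed

text \<open>In coordinates both defining inequalities compare polynomial expressions in the time component
  and the components of the vector, whose coefficients are continuous in the base point.\<close>

lemma open_chart_cone:
  assumes "c \<in> A"
  shows "open (chart_cone c)"
proof -
  define T where "T = (UNIV::real set) \<times> (snd c ` fst c) \<times> (UNIV::'e set)"
  define x where "x p = chart_inv c (fst (snd p))" for p :: "real \<times> 'e \<times> 'e"
  define \<tau> where "\<tau> p = fst p" for p :: "real \<times> 'e \<times> 'e"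
  define v where "v p = snd (snd p)" for p :: "real \<times> 'e \<times> 'e"
  define w where "w p = \<omega> (x p) (coord_vec A c (v p) (x p))" for p
  define g where "g p = g0 (x p) (coord_vec A c (v p) (x p)) (coord_vec A c (v p) (x p))" for p
  have T: "open T" using open_chart_image[OF assms] by (auto simp: T_def intro!: open_Times)
  have x: "x p \<in> fst c" if "p \<in> T" for p
    using that chart_inv_in[OF assms] by (auto simp: T_def x_def)
  have v: "continuous_on T v" and t: "continuous_on T \<tau>"
    unfolding v_def \<tau>_def by (intro continuous_intros)+
  have comp: "continuous_on T (\<lambda>p. f (x p))"
    if "continuous_on (snd c ` fst c) (f \<circ> chart_inv c)" for f :: "'s \<Rightarrow> real"
  proof -
    have "(\<lambda>p. fst (snd p)) ` T \<subseteq> snd c ` fst c" by (auto simp: T_def)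
    moreover have "continuous_on T (\<lambda>p. fst (snd p))" by (intro continuous_intros)
    ultimately show ?thesis
      using continuous_on_compose2[OF that, of T "\<lambda>p. fst (snd p)"] by (simp add: x_def)
  qed
  have b: "continuous_on T (\<lambda>p. \<beta> (x p))"
    by (rule comp, rule smooth_on_imp_continuous_on)
      (use smooth_beta assms in \<open>simp add: smooth_function_def\<close>)
  have w: "continuous_on T w"
    unfolding w_def
  proof (rule continuous_on_linear_family[OF _ _ v])
    show "linear (\<lambda>e. \<omega> (x p) (coord_vec A c e (x p)))" if "p \<in> T" for p
      using linear_omega_coord x assms that by blast
    show "continuous_on T (\<lambda>p. \<omega> (x p) (coord_vec A c i (x p)))" for i
      by (rule comp, rule smooth_on_imp_continuous_on)
        (use one_form_omega assms in \<open>simp add: one_form_def\<close>)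
  qed
  have g: "continuous_on T g"
    unfolding g_def
  proof (rule continuous_on_linear_family[where
        f = "\<lambda>p e. g0 (x p) (coord_vec A c (v p) (x p)) (coord_vec A c e (x p))", OF _ _ v])
    show "linear (\<lambda>e. g0 (x p) (coord_vec A c (v p) (x p)) (coord_vec A c e (x p)))"
      if "p \<in> T" for p
      using linear_g0_coord_right x assms that by blast
    show "continuous_on T (\<lambda>p. g0 (x p) (coord_vec A c (v p) (x p)) (coord_vec A c i (x p)))" for i
    proof (rule continuous_on_linear_family[where
          f = "\<lambda>p e. g0 (x p) (coord_vec A c e (x p)) (coord_vec A c i (x p))", OF _ _ v])
      show "linear (\<lambda>e. g0 (x p) (coord_vec A c e (x p)) (coord_vec A c i (x p)))"
        if "p \<in> T" for p
        using linear_g0_coord_left x assms that by blast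
      show "continuous_on T (\<lambda>p. g0 (x p) (coord_vec A c j (x p)) (coord_vec A c i (x p)))" for j
        by (rule comp, rule smooth_on_imp_continuous_on)
          (use tensor_g0 assms in \<open>simp add: symmetric_2_tensor_def\<close>)
    qed
  qed
  have "chart_cone c = (T \<inter> (\<lambda>p. - \<beta> (x p) * \<tau> p * \<tau> p + 2 * \<tau> p * w p + g p) -` {..<0})
      \<inter> (T \<inter> (\<lambda>p. - \<beta> (x p) * \<tau> p + w p) -` {..<0})"
    using future_timelike_coord[OF assms] chart_inv_in[OF assms]
    by (auto simp: chart_cone_def T_def x_def \<tau>_def v_def w_def g_def)
  moreover have "open (T \<inter> (\<lambda>p. - \<beta> (x p) * \<tau> p * \<tau> p + 2 * \<tau> p * w p + g p) -` {..<0})"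
    by (intro continuous_open_preimage[OF _ T] continuous_intros b t w g)
  moreover have "open (T \<inter> (\<lambda>p. - \<beta> (x p) * \<tau> p + w p) -` {..<0})"
    by (intro continuous_open_preimage[OF _ T] continuous_intros b t w g)
  ultimately show ?thesis by (simp only: open_Int)
qed

lemma partial_t_in_chart_cone:
  assumes "c \<in> A" "x \<in> fst c"
  shows "(1, snd c x, 0) \<in> chart_cone c"
  using assms chart_inv_chart[OF assms] future_timelike_coord[OF assms, of 0 1 0]
    linear_0[OF linear_omega_coord[OF assms]] linear_0[OF linear_g0_coord_right[OF assms, of 0]]
    beta_pos[of x]
  by (simp add: chart_cone_def)


section \<open>Velocities of curves\<close>

lemma has_vector_derivative_coordinates:
  assumes "smooth_curve_on A J \<eta>" "s \<in> J" "c \<in> A" "snd (\<eta> s) \<in> fst c"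
  shows "((snd c \<circ> snd \<circ> \<eta>) has_vector_derivative
    vector_derivative (snd c \<circ> snd \<circ> \<eta>) (at s)) (at s)"
  using assms smooth_on_imp_differentiable[of "{s \<in> J. snd (\<eta> s) \<in> fst c}"]
  by (auto simp: smooth_curve_on_def vector_derivative_works[symmetric])

lemma has_vector_derivative_time:
  assumes "smooth_curve_on A J \<eta>" "s \<in> J"
  shows "((fst \<circ> \<eta>) has_vector_derivative vector_derivative (fst \<circ> \<eta>) (at s)) (at s)"
  using assms smooth_on_imp_differentiable[of J]
  by (auto simp: smooth_curve_on_def vector_derivative_works[symmetric])

lemma open_curve_in_chart:
  assumes "smooth_curve_on A J \<eta>" "open J" "open U"
  shows "open {s \<in> J. snd (\<eta> s) \<in> U}"
proof -
  have "{s \<in> J. snd (\<eta> s) \<in> U} = J \<inter> (snd \<circ> \<eta>) -` U" by auto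
  then show ?thesis
    using assms continuous_open_preimage[of J "snd \<circ> \<eta>" U] by (simp add: smooth_curve_on_def)
qed

text \<open>Near \<open>s\<close> the coordinates of the curve in a chart \<open>d\<close> are obtained from those in \<open>c\<close> by the
  transition map, so the velocity is determined by its coordinates in the single chart \<open>c\<close>.\<close>

lemma velocity_eq_coord_vec:
  assumes "smooth_curve_on A J \<eta>" "open J" "s \<in> J" "c \<in> A" "snd (\<eta> s) \<in> fst c"
  shows "velocity A \<eta> s = (vector_derivative (fst \<circ> \<eta>) (at s),
    coord_vec A c (vector_derivative (snd c \<circ> snd \<circ> \<eta>) (at s)) (snd (\<eta> s)))"
proof -
  have "vector_derivative (snd d \<circ> snd \<circ> \<eta>) (at s) =
      frechet_derivative (transition c d) (at (snd c (snd (\<eta> s))))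
        (vector_derivative (snd c \<circ> snd \<circ> \<eta>) (at s))"
    if d: "d \<in> A" "snd (\<eta> s) \<in> fst d" for d
  proof -
    let ?D = "frechet_derivative (transition c d) (at (snd c (snd (\<eta> s))))"
    let ?u = "snd c \<circ> snd \<circ> \<eta>"
    have u: "(?u has_derivative (\<lambda>h. h *\<^sub>R vector_derivative ?u (at s))) (at s)"
      using has_vector_derivative_coordinates[OF assms(1,3,4,5)]
      by (simp add: has_vector_derivative_def)
    have t: "(transition c d has_derivative ?D) (at (?u s))"
      using has_derivative_transition[OF assms(4) d(1) assms(5) d(2)] by simp
    have "linear ?D" using t has_derivative_linear by blast
    then have "((\<lambda>r. transition c d (?u r)) has_vector_derivative ?D (vector_derivative ?u (at s))) (at s)"
      using has_derivative_compose[OF u t] by (simp add: has_vector_derivative_def linear_scale)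
    then have "((snd d \<circ> snd \<circ> \<eta>) has_vector_derivative ?D (vector_derivative ?u (at s))) (at s)"
      by (rule has_vector_derivative_transform_within_open
          [OF _ open_curve_in_chart[OF assms(1,2) open_chart_domain[OF assms(4)]]])
        (use assms in \<open>auto simp: transition_def chart_inv_chart\<close>)
    then show ?thesis by (rule vector_derivative_at)
  qed
  then show ?thesis
    by (auto simp: velocity_def coord_vec_def fun_eq_iff simp del: split_paired_All)
qed

section \<open>Chains of timelike segments\<close>

text \<open>The shift by \<open>k\<close> of the parameter serves to concatenate segments, the shift by \<open>r\<close> of the time
  coordinate is the isometry generated by \<open>\<partial>\<^sub>t\<close>.\<close>

lemma smooth_timelike_segment_translate:
  assumes "smooth_timelike_segment A \<beta> \<omega> g0 a b \<gamma>"
  shows "smooth_timelike_segment A \<beta> \<omega> g0 (a + k) (b + k)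
    (\<lambda>s. (r + fst (\<gamma> (s - k)), snd (\<gamma> (s - k))))"
proof -
  obtain J \<eta> where J: "open J" "{a..b} \<subseteq> J" "smooth_curve_on A J \<eta>"
    and eta: "\<And>s. s \<in> {a..b} \<Longrightarrow> \<eta> s = \<gamma> s"
      "\<And>s. s \<in> {a..b} \<Longrightarrow> future_timelike \<beta> \<omega> g0 (\<eta> s) (velocity A \<eta> s)"
    using assms unfolding smooth_timelike_segment_def by blast
  define J' where "J' = {s. - k + s *\<^sub>R 1 \<in> J}"
  define \<zeta> where "\<zeta> s = (r + fst (\<eta> (s - k)), snd (\<eta> (s - k)))" for s
  have J': "s \<in> J' \<longleftrightarrow> s - k \<in> J" for s by (simp add: J'_def)
  have "J' = (\<lambda>s. s - k) -` J" using J' by auto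
  then have "open J'" using J(1) by (auto intro!: open_vimage continuous_intros)
  moreover have "{a + k..b + k} \<subseteq> J'"
  proof
    fix s assume "s \<in> {a + k..b + k}"
    then have "s - k \<in> {a..b}" by simp
    then show "s \<in> J'" using J(2) J' by blast
  qed
  moreover have "smooth_curve_on A J' \<zeta>"
    unfolding smooth_curve_on_def
  proof (intro conjI ballI)
    have "smooth_on J (fst \<circ> \<eta>)" using J(3) by (simp add: smooth_curve_on_def)
    from smooth_on_comp_affine[OF this J(1), of "-k" 1]
    have "smooth_on J' (\<lambda>s. (fst \<circ> \<eta>) (- k + s *\<^sub>R 1))" unfolding J'_def .
    then have "smooth_on J' (\<lambda>s. r + (fst \<circ> \<eta>) (- k + s *\<^sub>R 1))"
      unfolding smooth_on_def using Ck_on_add_const \<open>open J'\<close> by blast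
    then show "smooth_on J' (fst \<circ> \<zeta>)" by (simp add: \<zeta>_def o_def)
    have "continuous_on J (snd \<circ> \<eta>)" using J(3) by (simp add: smooth_curve_on_def)
    moreover have "continuous_on J' (\<lambda>s. s - k)" "(\<lambda>s. s - k) ` J' \<subseteq> J"
      using J' by (auto intro!: continuous_intros)
    ultimately show "continuous_on J' (snd \<circ> \<zeta>)"
      using continuous_on_compose2[of J "snd \<circ> \<eta>" J' "\<lambda>s. s - k"] by (simp add: \<zeta>_def o_def)
    fix c assume c: "c \<in> A"
    let ?N = "{s \<in> J. snd (\<eta> s) \<in> fst c}"
    have "smooth_on ?N (snd c \<circ> snd \<circ> \<eta>)" using J(3) c by (simp add: smooth_curve_on_def)
    from smooth_on_comp_affine[OF this open_curve_in_chart[OF J(3,1) open_chart_domain[OF c]], of "-k" 1]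
    show "smooth_on {s \<in> J'. snd (\<zeta> s) \<in> fst c} (snd c \<circ> snd \<circ> \<zeta>)"
      by (simp add: J' \<zeta>_def o_def)
  qed
  moreover have "future_timelike \<beta> \<omega> g0 (\<zeta> s) (velocity A \<zeta> s)" if "s \<in> {a + k..b + k}" for s
  proof -
    have *: "vector_derivative (\<lambda>s. c + f (s - k)) (at s) = vector_derivative f (at (s - k))"
      for c and f :: "real \<Rightarrow> 'z::real_normed_vector"
      unfolding vector_derivative_def has_vector_derivative_shift ..
    have "velocity A \<zeta> s = velocity A \<eta> (s - k)"
      using *[of r "fst \<circ> \<eta>"] *[of 0 "snd c \<circ> snd \<circ> \<eta>" for c :: "('s, 'e) chart"]
      by (simp add: velocity_def \<zeta>_def o_def cong: if_cong)
    moreover have "future_timelike \<beta> \<omega> g0 (\<eta> (s - k)) (velocity A \<eta> (s - k))"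
      using eta(2) that by simp
    ultimately show ?thesis by (simp add: \<zeta>_def future_timelike_def som_metric_def)
  qed
  moreover have "\<zeta> s = (r + fst (\<gamma> (s - k)), snd (\<gamma> (s - k)))" if "s \<in> {a + k..b + k}" for s
    using eta(1)[of "s - k"] that by (simp add: \<zeta>_def)
  ultimately show ?thesis unfolding smooth_timelike_segment_def by blast
qed

lemma smooth_timelike_segment_cong:
  assumes "smooth_timelike_segment A \<beta> \<omega> g0 a b \<gamma>" "\<And>s. s \<in> {a'..b'} \<Longrightarrow> \<gamma> s = \<gamma>' s"
    "{a'..b'} \<subseteq> {a..b}"
  shows "smooth_timelike_segment A \<beta> \<omega> g0 a' b' \<gamma>'"
proof -
  obtain J \<eta> where J: "open J" "{a..b} \<subseteq> J" "smooth_curve_on A J \<eta>"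
    and eta: "\<forall>s\<in>{a..b}. \<eta> s = \<gamma> s \<and> future_timelike \<beta> \<omega> g0 (\<eta> s) (velocity A \<eta> s)"
    using assms(1) unfolding smooth_timelike_segment_def by blast
  have "{a'..b'} \<subseteq> J"
    "\<forall>s\<in>{a'..b'}. \<eta> s = \<gamma>' s \<and> future_timelike \<beta> \<omega> g0 (\<eta> s) (velocity A \<eta> s)"
    using J(2) eta assms(2,3) by (blast, metis subsetD)
  then show ?thesis unfolding smooth_timelike_segment_def using J by blast
qed

text \<open>The existence of a single smooth timelike segment is easier to manipulate than that of a
  subdivided curve; the transitive closure of this relation is the chronology relation.\<close>

definition timelike_step :: "real \<times> 's \<Rightarrow> real \<times> 's \<Rightarrow> bool" where
  "timelike_step p q \<longleftrightarrow>
     (\<exists>a b \<gamma>. a < b \<and> smooth_timelike_segment A \<beta> \<omega> g0 a b \<gamma> \<and> \<gamma> a = p \<and> \<gamma> b = q)"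

text \<open>A chain of segments becomes a single curve by shifting the parameter of each new segment, which
  leaves its velocities unchanged.\<close>

lemma future_timelike_curve_iff_steps:
  "(\<exists>a b \<gamma>. future_timelike_curve A \<beta> \<omega> g0 a b \<gamma> \<and> \<gamma> a = p \<and> \<gamma> b = q) \<longleftrightarrow>
   timelike_step\<^sup>+\<^sup>+ p q"
proof
  assume "\<exists>a b \<gamma>. future_timelike_curve A \<beta> \<omega> g0 a b \<gamma> \<and> \<gamma> a = p \<and> \<gamma> b = q"
  then obtain a b \<gamma> n \<tau> where *: "a < b" "\<tau> 0 = a" "\<tau> n = b" "\<gamma> a = p" "\<gamma> b = q"
    "\<And>i. i < n \<Longrightarrow> \<tau> i < \<tau> (Suc i)"
    "\<And>i. i < n \<Longrightarrow> smooth_timelike_segment A \<beta> \<omega> g0 (\<tau> i) (\<tau> (Suc i)) \<gamma>"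
    unfolding future_timelike_curve_def by blast
  have step: "timelike_step (\<gamma> (\<tau> i)) (\<gamma> (\<tau> (Suc i)))" if "i < n" for i
    using * that unfolding timelike_step_def by blast
  have "timelike_step\<^sup>+\<^sup>+ (\<gamma> (\<tau> 0)) (\<gamma> (\<tau> (Suc i)))" if "i < n" for i
    using that
  proof (induction i)
    case 0
    then show ?case using step by blast
  next
    case (Suc i)
    then show ?case using step[of "Suc i"] by (meson Suc_lessD tranclp.trancl_into_trancl)
  qed
  moreover obtain m where "n = Suc m" using *(1,2,3) by (cases n) auto
  ultimately show "timelike_step\<^sup>+\<^sup>+ p q" using * by blast
next
  assume "timelike_step\<^sup>+\<^sup>+ p q"
  then show "\<exists>a b \<gamma>. future_timelike_curve A \<beta> \<omega> g0 a b \<gamma> \<and> \<gamma> a = p \<and> \<gamma> b = q"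
  proof induction
    case (base q)
    then obtain a b \<gamma> where "a < b" "smooth_timelike_segment A \<beta> \<omega> g0 a b \<gamma>" "\<gamma> a = p" "\<gamma> b = q"
      unfolding timelike_step_def by blast
    moreover from this have "future_timelike_curve A \<beta> \<omega> g0 a b \<gamma>"
      unfolding future_timelike_curve_def
      by (auto intro!: exI[of _ 1] exI[of _ "\<lambda>i::nat. if i = 0 then a else b"])
    ultimately show ?case by blast
  next
    case (step q q')
    obtain c d \<eta> where eta: "c < d" "smooth_timelike_segment A \<beta> \<omega> g0 c d \<eta>" "\<eta> c = q" "\<eta> d = q'"
      using step.hyps(2) unfolding timelike_step_def by blast
    obtain a b \<gamma> n \<tau> where *: "a < b" "\<tau> 0 = a" "\<tau> n = b" "\<gamma> a = p" "\<gamma> b = q"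
      "\<And>i. i < n \<Longrightarrow> \<tau> i < \<tau> (Suc i)"
      "\<And>i. i < n \<Longrightarrow> smooth_timelike_segment A \<beta> \<omega> g0 (\<tau> i) (\<tau> (Suc i)) \<gamma>"
      using step.IH unfolding future_timelike_curve_def by blast
    have tau_le: "\<tau> i \<le> b" if "i \<le> n" for i
      using that
    proof (induction i rule: inc_induct)
      case base
      then show ?case using * by simp
    next
      case (step i)
      then show ?case using *(6)[of i] by linarith
    qed
    \<comment> \<open>The new segment is shifted in its parameter by \<open>b - c\<close> to start where the chain ends.\<close>
    define \<gamma>' where "\<gamma>' s = (if s \<le> b then \<gamma> s else \<eta> (s - (b - c)))" for s
    define \<tau>' where "\<tau>' i = (if i \<le> n then \<tau> i else d + (b - c))" for i
    have "smooth_timelike_segment A \<beta> \<omega> g0 (c + (b - c)) (d + (b - c)) \<gamma>'"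
      using smooth_timelike_segment_translate[OF eta(2), of "b - c" 0]
      by (rule smooth_timelike_segment_cong) (use eta * in \<open>auto simp: \<gamma>'_def\<close>)
    moreover have "smooth_timelike_segment A \<beta> \<omega> g0 (\<tau> i) (\<tau> (Suc i)) \<gamma>'" if "i < n" for i
      using *(7)[OF that]
      by (rule smooth_timelike_segment_cong) (use tau_le[of "Suc i"] that in \<open>auto simp: \<gamma>'_def\<close>)
    ultimately have "\<tau>' i < \<tau>' (Suc i) \<and> smooth_timelike_segment A \<beta> \<omega> g0 (\<tau>' i) (\<tau>' (Suc i)) \<gamma>'"
      if "i < Suc n" for i
      using that *(3,6) eta(1) by (cases "i = n") (auto simp: \<tau>'_def)
    then have "future_timelike_curve A \<beta> \<omega> g0 a (d + (b - c)) \<gamma>'"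
      unfolding future_timelike_curve_def using eta(1) *(1,2)
      by (auto intro!: exI[of _ "Suc n"] exI[of _ \<tau>'] simp: \<tau>'_def)
    moreover have "\<gamma>' a = p" "\<gamma>' (d + (b - c)) = q'"
      using * eta by (auto simp: \<gamma>'_def)
    ultimately show ?case by blast
  qed
qed

lemma timelike_step_translate:
  assumes "timelike_step p q"
  shows "timelike_step (r + fst p, snd p) (r + fst q, snd q)"
proof -
  obtain a b \<gamma> where *: "a < b" "smooth_timelike_segment A \<beta> \<omega> g0 a b \<gamma>" "\<gamma> a = p" "\<gamma> b = q"
    using assms unfolding timelike_step_def by blast
  then show ?thesis
    using smooth_timelike_segment_translate[OF *(2), of 0 r] unfolding timelike_step_def
    by (intro exI[of _ a] exI[of _ b] exI[of _ "\<lambda>s. (r + fst (\<gamma> s), snd (\<gamma> s))"]) simp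
qed

lemma timelike_steps_translate:
  assumes "timelike_step\<^sup>+\<^sup>+ p q"
  shows "timelike_step\<^sup>+\<^sup>+ (r + fst p, snd p) (r + fst q, snd q)"
  using assms
proof induction
  case (base q)
  then show ?case using timelike_step_translate by blast
next
  case (step q q')
  then show ?case using timelike_step_translate by (meson tranclp.trancl_into_trancl)
qed

section \<open>Straight segments in a chart\<close>

text \<open>In every other chart the line is a transition map composed with an affine map, so it is smooth
  there, too.\<close>

lemma timelike_step_line:
  assumes c: "c \<in> A" and h: "h > 0" and cone: "\<And>s. s \<in> {0..h} \<Longrightarrow> (\<tau>, \<xi> + s *\<^sub>R v, v) \<in> chart_cone c"
  shows "timelike_step (t, chart_inv c \<xi>) (t + h * \<tau>, chart_inv c (\<xi> + h *\<^sub>R v))"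
proof -
  define J where "J = {s. \<xi> + s *\<^sub>R v \<in> snd c ` fst c}"
  define \<eta> where "\<eta> s = (t + s * \<tau>, chart_inv c (\<xi> + s *\<^sub>R v))" for s
  have "J = (\<lambda>s. \<xi> + s *\<^sub>R v) -` (snd c ` fst c)" by (auto simp: J_def)
  then have J: "open J"
    using open_chart_image[OF c] by (auto intro!: open_vimage continuous_intros)
  have sub: "{0..h} \<subseteq> J" using cone by (auto simp: J_def chart_cone_def)
  have smooth: "smooth_curve_on A J \<eta>"
    unfolding smooth_curve_on_def
  proof (intro conjI ballI)
    have "smooth_on UNIV (\<lambda>s. t + s *\<^sub>R \<tau>)"
      using smooth_on_comp_affine[OF smooth_on_id, of UNIV t \<tau>] by simp
    then show "smooth_on J (fst \<circ> \<eta>)"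
      by (auto simp: \<eta>_def o_def intro: smooth_on_subset)
    show "continuous_on J (snd \<circ> \<eta>)"
      unfolding \<eta>_def o_def snd_conv
      by (rule continuous_on_compose2[OF continuous_on_chart_inv[OF c]])
        (auto simp: J_def intro!: continuous_intros)
    fix d assume d: "d \<in> A"
    let ?W = "snd c ` (fst c \<inter> fst d)"
    have "smooth_on ?W (transition c d)" using atlas c d by (auto simp: smooth_atlas_def)
    from smooth_on_comp_affine[OF this open_overlap_image[OF c d], of \<xi> v]
    show "smooth_on {s \<in> J. snd (\<eta> s) \<in> fst d} (snd d \<circ> snd \<circ> \<eta>)"
      unfolding overlap_image[OF c] by (simp add: J_def \<eta>_def transition_def o_def)
  qed
  have "future_timelike \<beta> \<omega> g0 (\<eta> s) (velocity A \<eta> s)" if s: "s \<in> {0..h}" for s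
  proof -
    have sJ: "s \<in> J" using sub s by blast
    then have x: "snd (\<eta> s) \<in> fst c" using chart_inv_in[OF c] by (simp add: J_def \<eta>_def)
    have "((\<lambda>s. t + s * \<tau>) has_vector_derivative \<tau>) (at s)"
      by (auto intro!: derivative_eq_intros simp: has_vector_derivative_def)
    then have t: "vector_derivative (fst \<circ> \<eta>) (at s) = \<tau>"
      by (auto intro!: vector_derivative_at simp: \<eta>_def o_def)
    have "((\<lambda>s. \<xi> + s *\<^sub>R v) has_vector_derivative v) (at s)"
      by (auto intro!: derivative_eq_intros simp: has_vector_derivative_def)
    then have "((snd c \<circ> snd \<circ> \<eta>) has_vector_derivative v) (at s)"
      by (rule has_vector_derivative_transform_within_open[OF _ J sJ])
        (use chart_chart_inv[OF c] in \<open>auto simp: J_def \<eta>_def\<close>)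
    then have v: "vector_derivative (snd c \<circ> snd \<circ> \<eta>) (at s) = v"
      by (rule vector_derivative_at)
    have "velocity A \<eta> s = (\<tau>, coord_vec A c v (snd (\<eta> s)))"
      using velocity_eq_coord_vec[OF smooth J sJ c x] unfolding t v .
    moreover have "future_timelike \<beta> \<omega> g0 (fst (\<eta> s), snd (\<eta> s)) (\<tau>, coord_vec A c v (snd (\<eta> s)))"
      using cone[OF s] unfolding future_timelike_time_invariant[of "fst (\<eta> s)" _ _ 0]
      by (simp add: chart_cone_def \<eta>_def)
    ultimately show ?thesis by simp
  qed
  then have "smooth_timelike_segment A \<beta> \<omega> g0 0 h \<eta>"
    using J sub smooth unfolding smooth_timelike_segment_def by blast
  moreover have "\<eta> 0 = (t, chart_inv c \<xi>)" "\<eta> h = (t + h * \<tau>, chart_inv c (\<xi> + h *\<^sub>R v))"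
    by (simp_all add: \<eta>_def)
  ultimately show ?thesis using h unfolding timelike_step_def by blast
qed

text \<open>A neighbourhood of a point of the open cone contains a product of balls. Since balls are convex,
  the coordinate line between two points of the ball around \<open>\<xi>\<close> stays inside it, so it is a
  timelike segment if its velocity lies in the other two balls. The bounds are
  uniform in the duration \<open>h\<close>, which may thus be fixed or tend to 0.\<close>

lemma timelike_step_near_cone:
  assumes c: "c \<in> A" and cone: "(\<tau>, \<xi>, v) \<in> chart_cone c"
  obtains r where "r > 0" "\<And>h x y t \<sigma>. h > 0 \<Longrightarrow> x \<in> fst c \<Longrightarrow> y \<in> fst c \<Longrightarrow>
    snd c x \<in> ball \<xi> r \<Longrightarrow> snd c y \<in> ball \<xi> r \<Longrightarrow> \<sigma> \<in> ball \<tau> r \<Longrightarrow>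
    (snd c y - snd c x) /\<^sub>R h \<in> ball v r \<Longrightarrow> timelike_step (t, x) (t + h * \<sigma>, y)"
proof -
  obtain B1 B' where B1: "open B1" "\<tau> \<in> B1" and B': "open B'" "(\<xi>, v) \<in> B'" "B1 \<times> B' \<subseteq> chart_cone c"
    using open_prod_elim[OF open_chart_cone[OF c] cone] by (metis mem_Times_iff fst_conv snd_conv)
  obtain B2 B3 where B2: "open B2" "\<xi> \<in> B2" and B3: "open B3" "v \<in> B3" "B2 \<times> B3 \<subseteq> B'"
    using open_prod_elim[OF B'(1,2)] by (metis mem_Times_iff fst_conv snd_conv)
  obtain r1 r2 r3 where r: "r1 > 0" "ball \<tau> r1 \<subseteq> B1" "r2 > 0" "ball \<xi> r2 \<subseteq> B2"
    "r3 > 0" "ball v r3 \<subseteq> B3"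
    using B1 B2 B3 by (meson open_contains_ball)
  define r where "r = min r1 (min r2 r3)"
  have "r > 0" using r by (simp add: r_def)
  moreover have "timelike_step (t, x) (t + h * \<sigma>, y)"
    if h: "h > 0" and x: "x \<in> fst c" "snd c x \<in> ball \<xi> r" and y: "y \<in> fst c" "snd c y \<in> ball \<xi> r"
      and s: "\<sigma> \<in> ball \<tau> r" and w: "(snd c y - snd c x) /\<^sub>R h \<in> ball v r" for h x y t \<sigma>
  proof -
    let ?w = "(snd c y - snd c x) /\<^sub>R h"
    have hw: "snd c x + h *\<^sub>R ?w = snd c y" using h by simp
    have "(\<sigma>, snd c x + u *\<^sub>R ?w, ?w) \<in> chart_cone c" if "u \<in> {0..h}" for u
    proof -
      have "snd c x + u *\<^sub>R ?w = (1 - u / h) *\<^sub>R snd c x + (u / h) *\<^sub>R snd c y"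
        using h by (simp add: algebra_simps divide_inverse)
      moreover have "0 \<le> u / h" "u / h \<le> 1" using that h by auto
      ultimately have "snd c x + u *\<^sub>R ?w \<in> ball \<xi> r"
        using convexD[OF convex_ball x(2) y(2), of "1 - u / h" "u / h"] by simp
      moreover have "ball \<xi> r \<subseteq> B2" "ball \<tau> r \<subseteq> B1" "ball v r \<subseteq> B3"
        using r by (auto simp: r_def)
      ultimately have "snd c x + u *\<^sub>R ?w \<in> B2" "\<sigma> \<in> B1" "?w \<in> B3"
        using s w by (simp_all only: subset_iff)
      then have "(\<sigma>, snd c x + u *\<^sub>R ?w, ?w) \<in> B1 \<times> B'" using B3(3) by (simp add: subset_iff)
      then show ?thesis using B'(3) by (rule subsetD[rotated])
    qed
    from timelike_step_line[OF c h this, of t] show ?thesis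
      unfolding hw using chart_inv_chart[OF c] x(1) y(1) by simp
  qed
  ultimately show ?thesis using that by blast
qed

text \<open>The vector \<open>\<partial>\<^sub>t\<close> is future timelike, so a segment that takes time \<open>\<epsilon>\<close> to cover a sufficiently
  small coordinate distance is future timelike, too.\<close>

lemma timelike_step_to_neighbours:
  assumes "\<epsilon> > 0"
  obtains U where "open U" "y \<in> U"
    "\<And>z. z \<in> U \<Longrightarrow> timelike_step (0, y) (\<epsilon>, z)" "\<And>z. z \<in> U \<Longrightarrow> timelike_step (0, z) (\<epsilon>, y)"
proof -
  obtain c where c: "c \<in> A" "y \<in> fst c" using chart_at by blast
  obtain r where r: "r > 0" "\<And>h x z t \<sigma>. h > 0 \<Longrightarrow> x \<in> fst c \<Longrightarrow> z \<in> fst c \<Longrightarrow>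
    snd c x \<in> ball (snd c y) r \<Longrightarrow> snd c z \<in> ball (snd c y) r \<Longrightarrow> \<sigma> \<in> ball 1 r \<Longrightarrow>
    (snd c z - snd c x) /\<^sub>R h \<in> ball 0 r \<Longrightarrow> timelike_step (t, x) (t + h * \<sigma>, z)"
    using timelike_step_near_cone[OF c(1) partial_t_in_chart_cone[OF c]] by metis
  \<comment> \<open>The points have to lie in the ball of radius \<open>r\<close>, and the coordinate distance divided by the
    duration \<open>\<epsilon>\<close> has to be less than \<open>r\<close>.\<close>
  define R where "R = min r (\<epsilon> * r)"
  define U where "U = fst c \<inter> snd c -` ball (snd c y) R"
  have R: "R > 0" using r assms by (simp add: R_def)
  have "open U"
    unfolding U_def using continuous_open_preimage[OF continuous_on_chart] open_chart_domain c by blast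
  moreover have "y \<in> U" using c R by (simp add: U_def)
  moreover have "timelike_step (0, y) (\<epsilon>, z) \<and> timelike_step (0, z) (\<epsilon>, y)" if "z \<in> U" for z
  proof -
    have z: "z \<in> fst c" "dist (snd c y) (snd c z) < r" "norm (snd c z - snd c y) < \<epsilon> * r"
      using that by (auto simp: U_def R_def dist_norm norm_minus_commute)
    then have "(snd c z - snd c y) /\<^sub>R \<epsilon> \<in> ball 0 r" "(snd c y - snd c z) /\<^sub>R \<epsilon> \<in> ball 0 r"
      using assms by (auto simp: norm_minus_commute divide_simps mult.commute)
    then show ?thesis
      using r(2)[of \<epsilon> y z 1 0] r(2)[of \<epsilon> z y 1 0] z c assms r(1) by simp
  qed
  ultimately show ?thesis using that by blast
qed

text \<open>Lowering the time component of the final velocity \<open>(\<alpha>, v)\<close> by a small \<open>\<delta>\<close> keeps it future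
  timelike. The difference quotient of the curve over the last \<open>h\<close> units of parameter is close to
  \<open>(\<alpha>, v)\<close> for small \<open>h\<close>; hence the coordinate line that covers the same spatial chord but
  advances \<open>t\<close> by \<open>h \<delta>\<close> less is timelike.\<close>

lemma timelike_step_improve:
  assumes "timelike_step p (s, y)"
  obtains s' where "s' < s" "timelike_step\<^sup>+\<^sup>+ p (s', y)"
proof -
  obtain a b \<gamma> where ab: "a < b" "\<gamma> a = p" "\<gamma> b = (s, y)"
    and seg: "smooth_timelike_segment A \<beta> \<omega> g0 a b \<gamma>"
    using assms unfolding timelike_step_def by blast
  obtain J \<eta> where J: "open J" "{a..b} \<subseteq> J" "smooth_curve_on A J \<eta>"
    and eta: "\<And>s. s \<in> {a..b} \<Longrightarrow> \<eta> s = \<gamma> s"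
      "\<And>s. s \<in> {a..b} \<Longrightarrow> future_timelike \<beta> \<omega> g0 (\<eta> s) (velocity A \<eta> s)"
    using seg unfolding smooth_timelike_segment_def by blast
  obtain c where c: "c \<in> A" "y \<in> fst c" using chart_at by blast
  define u where "u = snd c \<circ> snd \<circ> \<eta>"
  define v where "v = vector_derivative u (at b)"
  define \<alpha> where "\<alpha> = vector_derivative (fst \<circ> \<eta>) (at b)"
  have b: "b \<in> J" "\<eta> b = (s, y)" using J ab eta(1)[of b] by auto
  have "(\<alpha>, snd c y, v) \<in> chart_cone c"
    using eta(2)[of b] ab(1) b velocity_eq_coord_vec[OF J(3,1) b(1) c(1)] c chart_inv_chart[OF c]
    unfolding b future_timelike_time_invariant[of s _ _ 0]
    by (simp add: chart_cone_def u_def v_def \<alpha>_def)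
  then obtain B B' where B: "open B" "\<alpha> \<in> B" "(snd c y, v) \<in> B'" "B \<times> B' \<subseteq> chart_cone c"
    using open_prod_elim[OF open_chart_cone[OF c(1)]] by (metis mem_Times_iff fst_conv snd_conv)
  obtain e where e: "e > 0" "ball \<alpha> e \<subseteq> B" using B by (meson open_contains_ball)
  \<comment> \<open>Any amount below \<open>e\<close> keeps the lowered velocity inside the cone.\<close>
  define \<delta> where "\<delta> = e / 2"
  have "\<delta> > 0" "\<alpha> - \<delta> \<in> B" using e by (auto simp: \<delta>_def dist_real_def)
  then have "(\<alpha> - \<delta>, snd c y, v) \<in> chart_cone c" using B by blast
  then obtain r where r: "r > 0" "\<And>h x z t \<sigma>. h > 0 \<Longrightarrow> x \<in> fst c \<Longrightarrow> z \<in> fst c \<Longrightarrow>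
    snd c x \<in> ball (snd c y) r \<Longrightarrow> snd c z \<in> ball (snd c y) r \<Longrightarrow> \<sigma> \<in> ball (\<alpha> - \<delta>) r \<Longrightarrow>
    (snd c z - snd c x) /\<^sub>R h \<in> ball v r \<Longrightarrow> timelike_step (t, x) (t + h * \<sigma>, z)"
    using timelike_step_near_cone[OF c(1)] by metis
  have du: "(u has_derivative (\<lambda>h. h *\<^sub>R v)) (at b)"
    using has_vector_derivative_coordinates[OF J(3) b(1) c(1)] b c
    by (simp add: u_def v_def has_vector_derivative_def)
  have dt: "((fst \<circ> \<eta>) has_derivative (\<lambda>h. h *\<^sub>R \<alpha>)) (at b)"
    using has_vector_derivative_time[OF J(3) b(1)] by (simp add: \<alpha>_def has_vector_derivative_def)
  obtain d1 where d1: "d1 > 0" "\<And>z. norm (z - b) < d1 \<Longrightarrow>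
      norm (u z - u b - (z - b) *\<^sub>R v) \<le> r / 2 * norm (z - b)"
    using du r(1) unfolding has_derivative_at_alt by (meson half_gt_zero)
  obtain d2 where d2: "d2 > 0" "\<And>z. norm (z - b) < d2 \<Longrightarrow>
      norm ((fst \<circ> \<eta>) z - (fst \<circ> \<eta>) b - (z - b) *\<^sub>R \<alpha>) \<le> r / 2 * norm (z - b)"
    using dt r(1) unfolding has_derivative_at_alt by (meson half_gt_zero)
  define N where "N = {z \<in> J. snd (\<eta> z) \<in> fst c \<inter> snd c -` ball (snd c y) r}"
  have "open (fst c \<inter> snd c -` ball (snd c y) r)"
    using continuous_open_preimage[OF continuous_on_chart] open_chart_domain c by blast
  then have "open N" unfolding N_def by (rule open_curve_in_chart[OF J(3,1)])
  moreover have "b \<in> N" using b c r(1) by (simp add: N_def)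
  ultimately obtain d3 where d3: "d3 > 0" "ball b d3 \<subseteq> N" by (meson open_contains_ball)
  define h where "h = min (min d1 d2) (min d3 (b - a)) / 2"
  have h: "h > 0" "h < d1" "h < d2" "h < d3" "h < b - a"
    using d1 d2 d3 ab by (auto simp: h_def)
  obtain t x where tx: "\<eta> (b - h) = (t, x)" by fastforce
  have "b - h \<in> N" using h d3 by (auto simp: dist_real_def)
  then have x: "x \<in> fst c" "snd c x \<in> ball (snd c y) r" using tx by (auto simp: N_def)
  \<comment> \<open>The time component of the velocity of the chord from \<open>(t, x)\<close> to \<open>(s - h * \<delta>, y)\<close>.\<close>
  define \<sigma> where "\<sigma> = (s - t) / h - \<delta>"
  have "norm (snd c x - snd c y + h *\<^sub>R v) \<le> r / 2 * h"
    using d1(2)[of "b - h"] h tx b by (simp add: u_def)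
  moreover have "snd c x - snd c y + h *\<^sub>R v = h *\<^sub>R (v - (snd c y - snd c x) /\<^sub>R h)"
    using h by (simp add: algebra_simps)
  ultimately have "h * norm (v - (snd c y - snd c x) /\<^sub>R h) \<le> h * (r / 2)"
    using h by (simp add: mult.commute)
  then have w: "(snd c y - snd c x) /\<^sub>R h \<in> ball v r"
    using h r(1) mult_le_cancel_left_pos[of h "norm (v - (snd c y - snd c x) /\<^sub>R h)" "r / 2"]
    by (simp add: dist_norm)
  have "\<bar>t - s + h * \<alpha>\<bar> \<le> r / 2 * h"
    using d2(2)[of "b - h"] h tx b by simp
  moreover have "t - s + h * \<alpha> = h * (\<alpha> - \<delta> - \<sigma>)"
    using h by (simp add: \<sigma>_def field_simps)
  ultimately have "h * \<bar>\<alpha> - \<delta> - \<sigma>\<bar> \<le> h * (r / 2)"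
    using h by (simp add: abs_mult mult.commute)
  then have sigma: "\<sigma> \<in> ball (\<alpha> - \<delta>) r"
    using h r(1) mult_le_cancel_left_pos[of h "\<bar>\<alpha> - \<delta> - \<sigma>\<bar>" "r / 2"] by (simp add: dist_real_def)
  have "timelike_step (t, x) (t + h * \<sigma>, y)"
    using r(2)[OF h(1) x(1) c(2) x(2) _ sigma w, of t] r(1) by simp
  moreover have "t + h * \<sigma> = s - h * \<delta>" using h by (simp add: \<sigma>_def field_simps)
  moreover have "timelike_step p (t, x)"
  proof -
    have "smooth_timelike_segment A \<beta> \<omega> g0 a (b - h) \<gamma>"
      using seg by (rule smooth_timelike_segment_cong) (use h in auto)
    moreover have "\<gamma> (b - h) = (t, x)" using eta(1)[of "b - h"] tx h by simp
    ultimately show ?thesis using h ab unfolding timelike_step_def by (intro exI[of _ a] exI[of _ "b - h"] exI[of _ \<gamma>]) auto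
  qed
  ultimately have "timelike_step\<^sup>+\<^sup>+ p (s - h * \<delta>, y)" by (metis tranclp.simps)
  moreover have "s - h * \<delta> < s" using h \<open>\<delta> > 0\<close> by simp
  ultimately show ?thesis using that by blast
qed

end

section \<open>Translation invariant chronology relations\<close>

text \<open>\<open>prec_improve\<close> expresses that futures are open in the direction of the \<open>t\<close>-lines, and
  \<open>prec_neighbours\<close> that nearby points of the base space reach each other with small delay.\<close>

locale stationary_chronology =
  fixes prec :: "real \<times> 's::topological_space \<Rightarrow> real \<times> 's \<Rightarrow> bool" (infix "\<lless>" 50)
  assumes prec_trans: "p \<lless> p' \<Longrightarrow> p' \<lless> p'' \<Longrightarrow> p \<lless> p''"
    and prec_translate: "(t, x) \<lless> (s, y) \<Longrightarrow> (r + t, x) \<lless> (r + s, y)"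
    and prec_improve: "p \<lless> (s, y) \<Longrightarrow> \<exists>s'<s. p \<lless> (s', y)"
    and prec_neighbours: "\<epsilon> > 0 \<Longrightarrow>
      \<exists>U. open U \<and> y \<in> U \<and> (\<forall>z\<in>U. (0, y) \<lless> (\<epsilon>, z) \<and> (0, z) \<lless> (\<epsilon>, y))"
    and connected_space: "connected (UNIV :: 's set)"
begin

definition delays :: "'s \<Rightarrow> 's \<Rightarrow> real set" where
  "delays x y = {t. (0, x) \<lless> (t, y)}"

lemma prec_iff_delays: "(t, x) \<lless> (s, y) \<longleftrightarrow> s - t \<in> delays x y"
  using prec_translate[of t x s y "-t"] prec_translate[of 0 x "s - t" y t]
  by (auto simp: delays_def)

lemma delays_add: "a \<in> delays x y \<Longrightarrow> b \<in> delays y z \<Longrightarrow> a + b \<in> delays x z"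
  using prec_trans prec_translate[of 0 y b z a] by (auto simp: delays_def)

lemma pos_in_delays_self: "\<epsilon> > 0 \<Longrightarrow> \<epsilon> \<in> delays x x"
  using prec_neighbours[of \<epsilon> x] by (auto simp: delays_def)

lemma delays_upward: "a \<in> delays x y \<Longrightarrow> a < b \<Longrightarrow> b \<in> delays x y"
  using delays_add[OF _ pos_in_delays_self[of "b - a"], of a x y] by simp

lemma delays_improve: "a \<in> delays x y \<Longrightarrow> \<exists>b<a. b \<in> delays x y"
  using prec_improve by (auto simp: delays_def)

text \<open>Points that are mutually reachable with delay 1 are reachable from \<open>x\<close> simultaneously. The set
  of points reachable from \<open>x\<close> and its complement are therefore both open.\<close>

lemma delays_nonempty: "delays x y \<noteq> {}"
proof -
  define R where "R = {y. delays x y \<noteq> {}}"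
  have stable: "\<exists>T. open T \<and> y \<in> T \<and> (\<forall>z\<in>T. z \<in> R \<longleftrightarrow> y \<in> R)" for y
  proof -
    have "\<exists>U. open U \<and> y \<in> U \<and> (\<forall>z\<in>U. 1 \<in> delays y z \<and> 1 \<in> delays z y)"
      using prec_neighbours[of 1 y] by (simp add: delays_def)
    then obtain U where U: "open U \<and> y \<in> U \<and> (\<forall>z\<in>U. 1 \<in> delays y z \<and> 1 \<in> delays z y)" ..
    have "z \<in> R \<longleftrightarrow> y \<in> R" if "z \<in> U" for z
    proof
      assume "z \<in> R"
      then obtain a where "a \<in> delays x z" by (auto simp: R_def)
      with delays_add[of a x z 1 y] U that show "y \<in> R" by (auto simp: R_def)
    next
      assume "y \<in> R"
      then obtain a where "a \<in> delays x y" by (auto simp: R_def)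
      with delays_add[of a x y 1 z] U that show "z \<in> R" by (auto simp: R_def)
    qed
    with U have "open U \<and> y \<in> U \<and> (\<forall>z\<in>U. z \<in> R \<longleftrightarrow> y \<in> R)" by blast
    then show ?thesis ..
  qed
  have op: "open {y. y \<in> R \<longleftrightarrow> b}" for b
  proof (subst open_subopen, rule ballI)
    fix y assume y: "y \<in> {y. y \<in> R \<longleftrightarrow> b}"
    from stable[of y] obtain T where "open T \<and> y \<in> T \<and> (\<forall>z\<in>T. z \<in> R \<longleftrightarrow> y \<in> R)" ..
    with y have "open T \<and> y \<in> T \<and> T \<subseteq> {y. y \<in> R \<longleftrightarrow> b}" by blast
    then show "\<exists>T. open T \<and> y \<in> T \<and> T \<subseteq> {y. y \<in> R \<longleftrightarrow> b}" ..
  qed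
  have "open R" "open (- R)" using op[of True] op[of False] by (simp_all add: Compl_eq)
  moreover have "x \<in> R" using pos_in_delays_self[of 1 x] by (auto simp: R_def)
  ultimately have "- R = {}"
    using connectedD[OF connected_space, of R "- R"] by auto
  then show ?thesis by (auto simp: R_def)
qed

lemma outer_continuous_if_total:
  assumes "\<And>p q. p \<lless> q"
  shows "outer_continuous (\<lambda>p. {q. p \<lless> q})" "outer_continuous (\<lambda>p. {q. q \<lless> p})"
  using assms by (auto simp: outer_continuous_def intro: exI[of _ UNIV])

text \<open>By \<open>delays_improve\<close> there is even a negative delay from \<open>x\<close> to itself. Any \<open>p\<close> reaches the
  \<open>t\<close>-line of \<open>x\<close>, can travel arbitrarily far into the past there, and then proceed to \<open>q\<close>.\<close>

lemma total_if_vicious: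
  assumes "a \<in> delays x x" "a \<le> 0"
  shows "p \<lless> q"
proof -
  obtain b where b: "b \<in> delays x x" "b < 0" using delays_improve[OF assms(1)] assms(2) by (meson order_less_le_trans)
  have iter: "of_nat (Suc n) * b \<in> delays x x" for n
  proof (induction n)
    case (Suc n)
    then show ?case using delays_add[OF b(1) Suc] by (simp add: algebra_simps)
  qed (use b in simp)
  obtain t y s z where pq: "p = (t, y)" "q = (s, z)" by fastforce
  obtain c d where cd: "c \<in> delays y x" "d \<in> delays x z" using delays_nonempty by blast
  obtain n where "of_nat n * (- b) > c + d - (s - t)" using b(2) reals_Archimedean3[of "-b"] by auto
  moreover have "of_nat n * (- b) \<le> of_nat (Suc n) * (- b)"
    using b(2) by (intro mult_right_mono) auto
  ultimately have "c + of_nat (Suc n) * b + d < s - t" by linarith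
  moreover have "c + of_nat (Suc n) * b + d \<in> delays y z"
    using delays_add[OF delays_add[OF cd(1) iter] cd(2)] .
  ultimately show ?thesis using delays_upward pq prec_iff_delays by blast
qed

text \<open>In the totally vicious case the sets of delays are unbounded below and this infimum has no
  meaning; it is used in the other case only.\<close>

definition delay :: "'s \<Rightarrow> 's \<Rightarrow> real" where
  "delay x y = Inf (delays x y)"

end

section \<open>The delay function\<close>

locale nonvicious_chronology = stationary_chronology prec
  for prec :: "real \<times> 's::topological_space \<Rightarrow> real \<times> 's \<Rightarrow> bool" (infix "\<lless>" 50) +
  assumes delays_self_pos: "a \<in> delays x x \<Longrightarrow> a > 0"
begin

lemma bdd_below_delays: "bdd_below (delays x y)"
proof -
  obtain b where "b \<in> delays y x" using delays_nonempty by blast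
  then have "- b \<le> a" if "a \<in> delays x y" for a
    using delays_self_pos[OF delays_add[OF that, of b x]] by simp
  then show ?thesis by (rule bdd_belowI)
qed

text \<open>The strict inequality says that the infimum is not a delay itself, which is \<open>delays_improve\<close>.\<close>

lemma in_delays_iff: "t \<in> delays x y \<longleftrightarrow> delay x y < t"
proof
  assume "t \<in> delays x y"
  then obtain s where "s < t" "s \<in> delays x y" using delays_improve by blast
  then show "delay x y < t"
    using cInf_lower[OF _ bdd_below_delays, of s x y] unfolding delay_def by simp
next
  assume "delay x y < t"
  then obtain s where "s \<in> delays x y" "s < t"
    using cInf_lessD[OF delays_nonempty, of x y t] unfolding delay_def by blast
  then show "t \<in> delays x y" using delays_upward by blast
qed

lemma prec_iff_delay: "p \<lless> q \<longleftrightarrow> delay (snd p) (snd q) < fst q - fst p"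
  using prec_iff_delays[of "fst p" "snd p" "fst q" "snd q"] by (simp add: in_delays_iff)

lemma delay_triangle: "delay x z \<le> delay x y + delay y z"
proof (rule field_le_epsilon)
  fix e :: real assume "e > 0"
  then have "delay x y + e / 2 \<in> delays x y" "delay y z + e / 2 \<in> delays y z"
    by (simp_all add: in_delays_iff)
  from delays_add[OF this] show "delay x z \<le> delay x y + delay y z + e"
    by (simp add: in_delays_iff)
qed

lemma delay_self: "delay x x = 0"
proof (rule antisym)
  show "delay x x \<le> 0"
    by (rule field_le_epsilon) (use pos_in_delays_self in_delays_iff in \<open>simp add: less_imp_le\<close>)
  show "0 \<le> delay x x"
  proof (rule ccontr)
    assume "\<not> 0 \<le> delay x x"
    then have "delay x x / 2 \<in> delays x x" "delay x x / 2 < 0" by (simp_all add: in_delays_iff)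
    then show False using delays_self_pos by fastforce
  qed
qed

lemma delay_near:
  assumes "\<epsilon> > 0"
  obtains U where "open U" "y \<in> U" "\<And>z. z \<in> U \<Longrightarrow> delay y z < \<epsilon> \<and> delay z y < \<epsilon>"
  using prec_neighbours[OF assms, of y] by (auto simp: prec_iff_delay)

text \<open>Moving either end point to a nearby point changes the delay by at most the delays between the
  two, by the triangle inequality, and these are small in both directions.\<close>

lemma continuous_on_delay: "continuous_on UNIV (\<lambda>(x, y). delay x y)"
proof -
  have "((\<lambda>(x, y). delay x y) \<longlongrightarrow> delay x0 y0) (at (x0, y0))" for x0 y0
  proof (rule tendstoI)
    fix e :: real assume "e > 0"
    then obtain U V where U: "open U" "x0 \<in> U" "\<And>z. z \<in> U \<Longrightarrow> delay x0 z < e / 2 \<and> delay z x0 < e / 2"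
      and V: "open V" "y0 \<in> V" "\<And>z. z \<in> V \<Longrightarrow> delay y0 z < e / 2 \<and> delay z y0 < e / 2"
      using delay_near[of "e / 2" x0] delay_near[of "e / 2" y0] by (metis half_gt_zero)
    have "dist (delay x y) (delay x0 y0) < e" if "x \<in> U" "y \<in> V" for x y
    proof -
      have "delay x y < delay x0 y0 + e"
        using U(3)[OF that(1)] V(3)[OF that(2)] delay_triangle[of x y x0] delay_triangle[of x0 y y0]
        by linarith
      moreover have "delay x0 y0 < delay x y + e"
        using U(3)[OF that(1)] V(3)[OF that(2)] delay_triangle[of x0 y0 x] delay_triangle[of x y0 y]
        by linarith
      ultimately show ?thesis by (simp add: dist_real_def abs_less_iff)
    qed
    then show "\<forall>\<^sub>F p in at (x0, y0). dist (case p of (x, y) \<Rightarrow> delay x y) (delay x0 y0) < e"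
      using U V open_Times[of U V]
      unfolding eventually_at_topological by (intro exI[of _ "U \<times> V"]) auto
  qed
  then show ?thesis by (auto simp: continuous_on_def)
qed

text \<open>The amount of time by which \<open>q\<close> has to be moved to the past to reach the boundary of the future
  of \<open>p\<close>. As a function of pairs it is continuous, unlike the relation \<open>\<lless>\<close> itself.\<close>

definition gap :: "real \<times> 's \<Rightarrow> real \<times> 's \<Rightarrow> real" where
  "gap p q = fst q - fst p - delay (snd p) (snd q)"

lemma prec_iff_gap: "p \<lless> q \<longleftrightarrow> 0 < gap p q"
  by (auto simp: gap_def prec_iff_delay)

lemma continuous_on_gap: "continuous_on UNIV (\<lambda>(p, q). gap p q)"
proof -
  have "continuous_on UNIV (\<lambda>r :: (real \<times> 's) \<times> (real \<times> 's). delay (snd (fst r)) (snd (snd r)))"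
    using continuous_on_compose2[OF continuous_on_delay,
        of UNIV "\<lambda>r :: (real \<times> 's) \<times> (real \<times> 's). (snd (fst r), snd (snd r))"]
    by (simp add: continuous_intros)
  then show ?thesis
    unfolding gap_def case_prod_beta by (intro continuous_intros)
qed

end

section \<open>Outer continuity and equality of futures\<close>

text \<open>For \<open>c = 1\<close> and \<open>c = - 1\<close> a boundary point of a future or past is approached along its
  \<open>t\<close>-line.\<close>

lemma closure_vertical:
  fixes t c :: real
  assumes "\<And>e. e > 0 \<Longrightarrow> (t + c * e, x) \<in> Q"
  shows "(t, x) \<in> closure Q"
proof (rule Lim_in_closed_set[OF closed_closure])
  show "((\<lambda>e. (t + c * e, x)) \<longlongrightarrow> (t, x)) (at_right 0)"
    by (auto intro!: tendsto_eq_intros)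
  show "\<forall>\<^sub>F e in at_right 0. (t + c * e, x) \<in> closure Q"
    using eventually_at_right_less[of "0::real"]
    by (rule eventually_mono) (use assms closure_subset in blast)
qed simp

text \<open>The complement of the closure of the set at \<open>p\<close> is where \<open>f p\<close> is negative. A compact set on
  which \<open>f p\<close> is negative has, by the tube argument, a neighbourhood of \<open>p\<close> on which this persists.\<close>

lemma outer_continuous_of_continuous_gap:
  fixes f :: "'m::topological_space \<Rightarrow> 'm \<Rightarrow> real"
  assumes "continuous_on UNIV (\<lambda>(p, q). f p q)"
    and zero: "\<And>p q. f p q = 0 \<Longrightarrow> q \<in> closure {q. 0 < f p q}"
  shows "outer_continuous (\<lambda>p. {q. 0 < f p q})"
proof -
  have clos: "closure {q. 0 < f p q} = {q. 0 \<le> f p q}" for p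
  proof
    have "continuous_on UNIV (\<lambda>q. f p q)"
      using continuous_on_compose2[OF assms(1), of UNIV "\<lambda>q. (p, q)"] by (simp add: continuous_intros)
    then have "closed {q. 0 \<le> f p q}" by (intro closed_Collect_le) auto
    then show "closure {q. 0 < f p q} \<subseteq> {q. 0 \<le> f p q}" by (intro closure_minimal) auto
    show "{q. 0 \<le> f p q} \<subseteq> closure {q. 0 < f p q}"
      using zero closure_subset[of "{q. 0 < f p q}"] by (force simp: le_less)
  qed
  have op: "open {(p, q). f p q < 0}"
    using open_Collect_less[OF assms(1) continuous_on_const[of UNIV 0]] by (simp add: case_prod_beta')
  show ?thesis
    unfolding outer_continuous_def clos
  proof (intro allI impI)
    fix p K assume K: "compact K \<and> K \<subseteq> UNIV - {q. 0 \<le> f p q}"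
    have "\<exists>U V. open U \<and> open V \<and> p \<in> U \<and> q \<in> V \<and> U \<times> V \<subseteq> {(p, q). f p q < 0}" if "q \<in> K" for q
    proof -
      have "(p, q) \<in> {(p, q). f p q < 0}" using K that by auto
      from open_prod_elim[OF op this] show ?thesis by (metis mem_Times_iff fst_conv snd_conv)
    qed
    then obtain U V where UV: "\<And>q. q \<in> K \<Longrightarrow> open (U q) \<and> open (V q) \<and> p \<in> U q \<and> q \<in> V q \<and>
        U q \<times> V q \<subseteq> {(p, q). f p q < 0}"
      by metis
    obtain D where D: "D \<subseteq> K" "finite D" "K \<subseteq> (\<Union>q\<in>D. V q)"
      using compactE_image[of K K V] K UV by blast
    have "open (\<Inter>q\<in>D. U q)" "p \<in> (\<Inter>q\<in>D. U q)" using D UV by (blast intro: open_INT)+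
    moreover have "K \<subseteq> UNIV - {q. 0 \<le> f p' q}" if p': "p' \<in> (\<Inter>q\<in>D. U q)" for p'
    proof
      fix q' assume "q' \<in> K"
      then obtain q where "q \<in> D" "q' \<in> V q" using D by blast
      then have "(p', q') \<in> {(p, q). f p q < 0}" using UV[of q] p' D by blast
      then show "q' \<in> UNIV - {q. 0 \<le> f p' q}" by simp
    qed
    ultimately show "\<exists>U. open U \<and> p \<in> U \<and> (\<forall>q\<in>U. K \<subseteq> UNIV - {qa. 0 \<le> f q qa})" by blast
  qed
qed

context nonvicious_chronology
begin

lemma gap_later: "gap p (fst q + a, snd q) = gap p q + a"
  and gap_earlier: "gap (fst q - a, snd q) p = gap q p + a"
  by (simp_all add: gap_def)

lemma outer_continuous_prec:
  shows "outer_continuous (\<lambda>p. {q. p \<lless> q})" "outer_continuous (\<lambda>p. {q. q \<lless> p})"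
proof -
  have "outer_continuous (\<lambda>p. {q. 0 < gap p q})"
  proof (rule outer_continuous_of_continuous_gap[OF continuous_on_gap])
    fix p q assume "gap p q = 0"
    then have "(fst q + 1 * e, snd q) \<in> {q. 0 < gap p q}" if "e > 0" for e
      using gap_later[of p q e] that by simp
    from closure_vertical[OF this] show "q \<in> closure {q. 0 < gap p q}" by simp
  qed
  then show "outer_continuous (\<lambda>p. {q. p \<lless> q})" by (simp only: prec_iff_gap)
  have "outer_continuous (\<lambda>p. {q. 0 < gap q p})"
  proof (rule outer_continuous_of_continuous_gap)
    show "continuous_on UNIV (\<lambda>(p, q). gap q p)"
      using continuous_on_compose2[OF continuous_on_gap, of UNIV prod.swap]
      by (simp add: continuous_on_swap case_prod_beta)
    fix p q assume "gap q p = 0"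
    then have "(fst q + (- 1) * e, snd q) \<in> {q. 0 < gap q p}" if "e > 0" for e
      using gap_earlier[of q e p] that by simp
    from closure_vertical[OF this] show "q \<in> closure {q. 0 < gap q p}" by simp
  qed
  then show "outer_continuous (\<lambda>p. {q. q \<lless> p})" by (simp only: prec_iff_gap)
qed

lemma prec_iff_arrival: "p \<lless> q \<longleftrightarrow> fst p + delay (snd p) (snd q) < fst q"
  and prec_iff_departure: "p \<lless> q \<longleftrightarrow> fst p < fst q - delay (snd p) (snd q)"
  by (simp only: prec_iff_delay, linarith)+

lemma future_eq_iff:
  "{r. p \<lless> r} = {r. q \<lless> r} \<longleftrightarrow>
     (\<forall>z. fst p + delay (snd p) z = fst q + delay (snd q) z)"
proof
  assume *: "{r. p \<lless> r} = {r. q \<lless> r}"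
  have **: "fst p + delay (snd p) z < s \<longleftrightarrow> fst q + delay (snd q) z < s" for s z
    using eqset_imp_iff[OF *, of "(s, z)"] by (simp add: prec_iff_arrival)
  have "fst p + delay (snd p) z = fst q + delay (snd q) z" for z
    using **[of z "fst p + delay (snd p) z"] **[of z "fst q + delay (snd q) z"] by linarith
  then show "\<forall>z. fst p + delay (snd p) z = fst q + delay (snd q) z" ..
next
  assume *: "\<forall>z. fst p + delay (snd p) z = fst q + delay (snd q) z"
  show "{r. p \<lless> r} = {r. q \<lless> r}"
    by (rule Collect_cong) (simp only: prec_iff_arrival *[rule_format])
qed

lemma past_eq_iff:
  "{r. r \<lless> p} = {r. r \<lless> q} \<longleftrightarrow>
     (\<forall>z. fst p - delay z (snd p) = fst q - delay z (snd q))"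
proof
  assume *: "{r. r \<lless> p} = {r. r \<lless> q}"
  have **: "s < fst p - delay z (snd p) \<longleftrightarrow> s < fst q - delay z (snd q)" for s z
    using eqset_imp_iff[OF *, of "(s, z)"] by (simp add: prec_iff_departure)
  have "fst p - delay z (snd p) = fst q - delay z (snd q)" for z
    using **[of "fst p - delay z (snd p)" z] **[of "fst q - delay z (snd q)" z] by linarith
  then show "\<forall>z. fst p - delay z (snd p) = fst q - delay z (snd q)" ..
next
  assume *: "\<forall>z. fst p - delay z (snd p) = fst q - delay z (snd q)"
  show "{r. r \<lless> p} = {r. r \<lless> q}"
    by (rule Collect_cong) (simp only: prec_iff_departure *[rule_format])
qed

text \<open>Evaluating either equation of delays at the two points themselves gives
  \<open>d x y = c = - d y x\<close>, where \<open>d\<close> is the delay and \<open>c\<close> the difference of the time coordinates.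
  These two values in turn give back both equations, by two applications of the triangle
  inequality. The condition on the two values does not distinguish between future and past.\<close>

lemma future_eq_iff_past_eq: "{r. p \<lless> r} = {r. q \<lless> r} \<longleftrightarrow> {r. r \<lless> p} = {r. r \<lless> q}"
proof -
  define R where "R \<longleftrightarrow>
    delay (snd p) (snd q) = fst q - fst p \<and> delay (snd q) (snd p) = fst p - fst q"
  have "(\<forall>z. fst p + delay (snd p) z = fst q + delay (snd q) z) \<longleftrightarrow> R"
  proof
    assume *: "\<forall>z. fst p + delay (snd p) z = fst q + delay (snd q) z"
    show R
      using *[rule_format, of "snd p"] *[rule_format, of "snd q"] by (simp add: R_def delay_self)
  next
    assume R
    show "\<forall>z. fst p + delay (snd p) z = fst q + delay (snd q) z"
    proof
      fix z show "fst p + delay (snd p) z = fst q + delay (snd q) z"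
        using delay_triangle[of "snd q" z "snd p"] delay_triangle[of "snd p" z "snd q"] \<open>R\<close>
        unfolding R_def by linarith
    qed
  qed
  moreover have "(\<forall>z. fst p - delay z (snd p) = fst q - delay z (snd q)) \<longleftrightarrow> R"
  proof
    assume *: "\<forall>z. fst p - delay z (snd p) = fst q - delay z (snd q)"
    show R
      using *[rule_format, of "snd p"] *[rule_format, of "snd q"] by (simp add: R_def delay_self)
  next
    assume R
    show "\<forall>z. fst p - delay z (snd p) = fst q - delay z (snd q)"
    proof
      fix z show "fst p - delay z (snd p) = fst q - delay z (snd q)"
        using delay_triangle[of z "snd p" "snd q"] delay_triangle[of z "snd q" "snd p"] \<open>R\<close>
        unfolding R_def by linarith
    qed
  qed
  ultimately show ?thesis unfolding future_eq_iff past_eq_iff by simp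
qed

end

context stationary_chronology
begin

text \<open>Here the space splits into the two cases that are treated separately: totally vicious, or with a
  finite delay function.\<close>

lemma total_or_nonvicious: "(\<forall>p q. p \<lless> q) \<or> nonvicious_chronology (\<lless>)"
proof (cases "\<exists>x a. a \<in> delays x x \<and> a \<le> 0")
  case True
  then show ?thesis using total_if_vicious by metis
next
  case False
  then have "nonvicious_chronology (\<lless>)"
    by unfold_locales (meson not_le)
  then show ?thesis ..
qed

lemma outer_continuous_future_past:
  "outer_continuous (\<lambda>p. {q. p \<lless> q})" "outer_continuous (\<lambda>p. {q. q \<lless> p})"
proof -
  have "outer_continuous (\<lambda>p. {q. p \<lless> q}) \<and> outer_continuous (\<lambda>p. {q. q \<lless> p})"
    using total_or_nonvicious
  proof
    assume "\<forall>p q. p \<lless> q"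
    then show ?thesis by (intro conjI outer_continuous_if_total; blast)
  next
    assume "nonvicious_chronology (\<lless>)"
    then show ?thesis by (intro conjI nonvicious_chronology.outer_continuous_prec)
  qed
  then show "outer_continuous (\<lambda>p. {q. p \<lless> q})" "outer_continuous (\<lambda>p. {q. q \<lless> p})"
    by (rule conjunct1, rule conjunct2)
qed

text \<open>In the totally vicious case all futures and pasts are equal to the whole space, so both sides
  state that there is only one event.\<close>

lemma future_distinguishing_iff_past:
  "(\<forall>p q. {r. p \<lless> r} = {r. q \<lless> r} \<longrightarrow> p = q) \<longleftrightarrow>
   (\<forall>p q. {r. r \<lless> p} = {r. r \<lless> q} \<longrightarrow> p = q)"
  using total_or_nonvicious
proof
  assume "\<forall>p q. p \<lless> q"
  then have "{r. p \<lless> r} = UNIV" "{r. r \<lless> p} = UNIV" for p by blast+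
  then show ?thesis by simp
next
  assume "nonvicious_chronology (\<lless>)"
  note eq = nonvicious_chronology.future_eq_iff_past_eq[OF this]
  show ?thesis by (intro iff_allI arg_cong2[where f = "(\<longrightarrow>)"] eq refl)
qed

end

section \<open>Causal continuity of SOM-spacetimes\<close>

context som_spacetime
begin

lemma stationary_chronology_steps: "stationary_chronology timelike_step\<^sup>+\<^sup>+"
proof
  show "timelike_step\<^sup>+\<^sup>+ p p''" if "timelike_step\<^sup>+\<^sup>+ p p'" "timelike_step\<^sup>+\<^sup>+ p' p''" for p p' p''
    using that by (rule tranclp_trans)
  show "timelike_step\<^sup>+\<^sup>+ (r + t, x) (r + s, y)" if "timelike_step\<^sup>+\<^sup>+ (t, x) (s, y)" for r t s x y
    using timelike_steps_translate[OF that, of r] by simp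
  show "\<exists>s'<s. timelike_step\<^sup>+\<^sup>+ p (s', y)" if "timelike_step\<^sup>+\<^sup>+ p (s, y)" for p s y
    using that
  proof cases
    case r_into_trancl
    then obtain s' where "s' < s" "timelike_step\<^sup>+\<^sup>+ p (s', y)"
      by (rule timelike_step_improve)
    then show ?thesis by blast
  next
    case step: (trancl_into_trancl p')
    from step(2) obtain s' where "s' < s" "timelike_step\<^sup>+\<^sup>+ p' (s', y)"
      by (rule timelike_step_improve)
    then show ?thesis using tranclp_trans[OF step(1)] by blast
  qed
  show "\<exists>U. open U \<and> y \<in> U \<and>
      (\<forall>z\<in>U. timelike_step\<^sup>+\<^sup>+ (0, y) (\<epsilon>, z) \<and> timelike_step\<^sup>+\<^sup>+ (0, z) (\<epsilon>, y))"
    if pos: "\<epsilon> > 0" for \<epsilon> y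
  proof -
    obtain U where "open U" "y \<in> U"
      "\<And>z. z \<in> U \<Longrightarrow> timelike_step (0, y) (\<epsilon>, z)" "\<And>z. z \<in> U \<Longrightarrow> timelike_step (0, z) (\<epsilon>, y)"
      by (rule timelike_step_to_neighbours[OF pos, of y]) blast
    then show ?thesis by (intro exI[of _ U]) (simp add: tranclp.r_into_trancl)
  qed
qed (rule connected_S)

lemma chron_future_eq_steps: "chron_future A \<beta> \<omega> g0 = (\<lambda>p. {q. timelike_step\<^sup>+\<^sup>+ p q})"
  and chron_past_eq_steps: "chron_past A \<beta> \<omega> g0 = (\<lambda>p. {q. timelike_step\<^sup>+\<^sup>+ q p})"
  by (auto simp: chron_future_def chron_past_def future_timelike_curve_iff_steps)

end

theorem corollary3p12:
  fixes A :: "('s::{t2_space, second_countable_topology}, 'e::euclidean_space) chart set"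
    and \<beta> :: "'s \<Rightarrow> real"
    and \<omega> :: "'s \<Rightarrow> ('s, 'e) tvec \<Rightarrow> real"
    and g0 :: "'s \<Rightarrow> ('s, 'e) tvec \<Rightarrow> ('s, 'e) tvec \<Rightarrow> real"
  assumes "som_spacetime A \<beta> \<omega> g0"
  shows "causally_continuous A \<beta> \<omega> g0 \<longleftrightarrow>
    future_distinguishing A \<beta> \<omega> g0 \<or> past_distinguishing A \<beta> \<omega> g0"
proof -
  interpret som_spacetime A \<beta> \<omega> g0 by fact
  interpret chron: stationary_chronology "timelike_step\<^sup>+\<^sup>+" by (rule stationary_chronology_steps)
  have "future_distinguishing A \<beta> \<omega> g0 \<longleftrightarrow> past_distinguishing A \<beta> \<omega> g0"
    unfolding future_distinguishing_def past_distinguishing_def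
      chron_future_eq_steps chron_past_eq_steps
    by (rule chron.future_distinguishing_iff_past)
  moreover have "outer_continuous (chron_future A \<beta> \<omega> g0)" "outer_continuous (chron_past A \<beta> \<omega> g0)"
    unfolding chron_future_eq_steps chron_past_eq_steps
    by (rule chron.outer_continuous_future_past)+
  ultimately show ?thesis by (auto simp: causally_continuous_def)
qed

end
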